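(* Let $n>2$, $1<p<\infty$ and $1\le q\le\infty$. Then there is a constant $C$, independent of $\varrho$ and $f$, such that for every ball $B(\varrho)\subset\mathbb R^n$ of radius $\varrho>0$ and every (weakly differentiable, integrable) function $f$ on $B(\varrho)$ with $\nabla f\in L^{p,q}(B(\varrho))$, $$\|f-\overline f\|_{L^{p,q}(B(\varrho))}\le C\varrho\,\|\nabla f\|_{L^{p,q}(B(\varrho))}.$$
   Context: $\overline f=\frac1{|B(\varrho)|}\int_{B(\varrho)}f\,dx$ is the mean of $f$ over $B(\varrho)$. Lorentz spaces: for measurable $f$ on $\Omega$, with $f_*(\alpha)=|\{x\in\Omega:|f(x)|>\alpha\}|$ and $f^*(t)=\inf\{\alpha>0:f_*(\alpha)\le t\}$, $\|f\|_{L^{p,q}(\Omega)}=\big(\int_0^\infty(t^{1/p}f^*(t))^q\frac{dt}t\big)^{1/q}$ for $q<\infty$ and $\|f\|_{L^{p,\infty}(\Omega)}=\sup_{t>0}t^{1/p}f^*(t)$. *)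

theory Defs
  imports "HOL-Analysis.Analysis"
begin

text \<open>
  Distribution function, rearrangement and Lorentz norm take values in $[0,\infty]$, and the
  functions may be vector-valued, \<open>\<bar>f x\<bar>\<close> being read as \<^term>\<open>norm (f x)\<close>.
\<close>

definition distribution_fun :: "'a::euclidean_space set \<Rightarrow> ('a \<Rightarrow> 'b::real_normed_vector) \<Rightarrow> real \<Rightarrow> ennreal"
  where "distribution_fun \<Omega> f \<alpha> = emeasure lebesgue {x \<in> \<Omega>. norm (f x) > \<alpha>}"

text \<open>The infimum of the empty set is \<open>\<infinity>\<close>.\<close>

definition decr_rearrangement :: "'a::euclidean_space set \<Rightarrow> ('a \<Rightarrow> 'b::real_normed_vector) \<Rightarrow> real \<Rightarrow> ennreal"
  where "decr_rearrangement \<Omega> f t =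
    (INF \<alpha>\<in>{\<alpha>. \<alpha> > 0 \<and> distribution_fun \<Omega> f \<alpha> \<le> ennreal t}. ennreal \<alpha>)"

text \<open>Real powers on $[0,\infty]$; only used with positive exponents.\<close>

definition ennpowr :: "ennreal \<Rightarrow> real \<Rightarrow> ennreal"
  where "ennpowr x r = (if x = \<infinity> then \<infinity> else ennreal (enn2real x powr r))"

definition lorentz_norm ::
    "real \<Rightarrow> ennreal \<Rightarrow> 'a::euclidean_space set \<Rightarrow> ('a \<Rightarrow> 'b::real_normed_vector) \<Rightarrow> ennreal"
  where "lorentz_norm p q \<Omega> f =
    (if q = \<infinity>
     then (SUP t\<in>{0<..}. ennreal (t powr (1 / p)) * decr_rearrangement \<Omega> f t)
     else ennpowr
       (\<integral>\<^sup>+ t\<in>{0<..}. ennpowr (ennreal (t powr (1 / p)) * decr_rearrangement \<Omega> f t) (enn2real q)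
          * ennreal (1 / t) \<partial>lborel)
       (1 / enn2real q))"

definition lorentz_space ::
    "real \<Rightarrow> ennreal \<Rightarrow> 'a::euclidean_space set \<Rightarrow> ('a \<Rightarrow> 'b::real_normed_vector) set"
  where "lorentz_space p q \<Omega> =
    {f. set_borel_measurable lebesgue \<Omega> f \<and> lorentz_norm p q \<Omega> f < \<infinity>}"

text \<open>\<open>Ck k\<close> is membership in $C^k$ of the whole space, by iterated partial derivatives.\<close>

primrec Ck :: "nat \<Rightarrow> ('a::euclidean_space \<Rightarrow> real) \<Rightarrow> bool"
  where
    "Ck 0 \<phi> \<longleftrightarrow> continuous_on UNIV \<phi>"
  | "Ck (Suc k) \<phi> \<longleftrightarrow>
       (\<forall>x. \<phi> differentiable (at x)) \<and> (\<forall>i\<in>Basis. Ck k (\<lambda>x. frechet_derivative \<phi> (at x) i))"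

text \<open>$C_c^\infty(\Omega)$, each function being extended by zero to the whole space.\<close>

definition test_functions :: "'a::euclidean_space set \<Rightarrow> ('a \<Rightarrow> real) set"
  where "test_functions \<Omega> =
    {\<phi>. (\<forall>k. Ck k \<phi>) \<and> compact (closure {x. \<phi> x \<noteq> 0}) \<and> closure {x. \<phi> x \<noteq> 0} \<subseteq> \<Omega>}"

definition locally_integrable_on :: "('a::euclidean_space \<Rightarrow> 'b::euclidean_space) \<Rightarrow> 'a set \<Rightarrow> bool"
    (infixr \<open>locally'_integrable'_on\<close> 46)
  where "f locally_integrable_on \<Omega> \<longleftrightarrow> (\<forall>K. compact K \<and> K \<subseteq> \<Omega> \<longrightarrow> f absolutely_integrable_on K)"

definition has_weak_gradient_on ::
    "('a::euclidean_space \<Rightarrow> real) \<Rightarrow> ('a \<Rightarrow> 'a) \<Rightarrow> 'a set \<Rightarrow> bool"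
  where "has_weak_gradient_on f G \<Omega> \<longleftrightarrow>
    f locally_integrable_on \<Omega> \<and> G locally_integrable_on \<Omega> \<and>
    (\<forall>\<phi>\<in>test_functions \<Omega>. \<forall>i\<in>Basis.
       (LINT x:\<Omega>|lebesgue. f x * frechet_derivative \<phi> (at x) i)
       = - (LINT x:\<Omega>|lebesgue. (G x \<bullet> i) * \<phi> x))"

definition mean_on :: "'a::euclidean_space set \<Rightarrow> ('a \<Rightarrow> real) \<Rightarrow> real"
  where "mean_on \<Omega> f = 1 / measure lebesgue \<Omega> * (LINT x:\<Omega>|lebesgue. f x)"

end

theory Submission
  imports Defs
begin

text \<open>
  Write $g^*$ for the decreasing rearrangement and $g^{**}(t) = \frac1t \int_0^t g^*$. The proof
  shows the pointwise estimate $(f - \overline f)^*(t) \le 2^{n+1} \varrho\, (\nabla f)^{**}(t)$;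
  Hardy's inequality in $L^q(dt/t)$, where $p > 1$ is used, then replaces $(\nabla f)^{**}$ by
  $(\nabla f)^*$ at the cost of a factor $\frac p{p-1}$.

  For a set $E \subseteq B(\varrho)$, integrate $|f(x) - f(y)| \le 2 \varrho \int_0^1
  |\nabla f(x + s(y - x))|\, ds$ over $x \in E$ and $y \in B(\varrho)$. For $s \le 1/2$ the map
  $x \mapsto x + s(y - x)$ carries $E$ to a set of measure at most $|E|$ with Jacobian at least
  $2^{-n}$, and the integral of $|\nabla f|$ over such a set is at most $\int_0^{|E|} (\nabla f)^*$
  by Hardy and Littlewood; for $s \ge 1/2$ the same is done in $y$, and
  $|E| \int_0^{|B|} (\nabla f)^* \le |B| \int_0^{|E|} (\nabla f)^*$. Hence $\int_E |f - \overline f|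
  \le 2^{n+1} \varrho \int_0^{|E|} (\nabla f)^*$, and taking for $E$ the superlevel sets of
  $|f - \overline f|$ gives the pointwise estimate. For weakly differentiable $f$ the segment
  inequality is applied to mollifications on smaller balls; averaging translates of $|\nabla f|$
  does not increase the bounds above, so only $f$, not $\nabla f$, has to be approximated.
\<close>

section \<open>Hardy's inequality\<close>

text \<open>The estimates are phrased through integrals over sets because the supremum of the
  integral of |grad f| over all sets of a given measure is unchanged by translation, does not grow
  under averaging, and grows under a dilation by a controlled factor. The rearrangement of a
  convolution or of a line integral has no such pointwise control, so the averaged rearrangement
  appears and has to be removed by Hardy's inequality. The same invariance gives bounds for
  mollifications of radius e in which only the unmollified gradient occurs, uniformly in e.

  The gradient identity for a mollification holds only at points whose closed e-ball lies in the
  domain. This forces concentric balls of radius r with r + e < \<rho>, which exhaust the ball by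
  monotone convergence. The mollifying kernel is not normalised: its mass N is compared with N f and
  cancelled.

  Origin of 2^(n+1) \<rho>: a segment has length at most 2 \<rho>, half of the parameter interval
  has length 1/2, the Jacobian costs 2^n, and the two halves contribute equal bounds.\<close>

lemma ennpowr_ennreal: "0 \<le> x \<Longrightarrow> ennpowr (ennreal x) r = ennreal (x powr r)"
  by (simp add: ennpowr_def)

lemma ennpowr_top [simp]: "ennpowr \<infinity> r = \<infinity>"
  by (simp add: ennpowr_def)

lemma ennpowr_mono:
  assumes "x \<le> y" "0 \<le> r" shows "ennpowr x r \<le> ennpowr y r"
  using assms
  by (cases x; cases y) (auto simp: ennpowr_def top_unique intro!: ennreal_leI powr_mono2)

lemma ennpowr_mult_left:
  assumes "0 < c" shows "ennpowr (ennreal c * x) r = ennreal (c powr r) * ennpowr x r"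
  using assms
  by (cases x) (auto simp: ennpowr_def ennreal_mult_top ennreal_mult[symmetric] powr_mult)

lemma borel_measurable_ennpowr [measurable]:
  assumes [measurable]: "f \<in> borel_measurable M"
  shows "(\<lambda>x. ennpowr (f x) r) \<in> borel_measurable M"
  unfolding ennpowr_def by measurable

lemma ennpowr_tangent:
  fixes q a :: real
  assumes "1 \<le> q" "0 < a"
  shows "ennreal (q * a powr (q - 1)) * x \<le> ennpowr x q + ennreal ((q - 1) * a powr q)"
proof (cases x)
  case (real y)
  have "q * a powr (q - 1) * y \<le> y powr q + (q - 1) * a powr q"
  proof (cases "q = 1")
    case False
    then have q: "q > 1" using assms by simp
    \<comment> \<open>Young's inequality for y and a^(q-1) with the conjugate exponents q and
      q/(q-1).\<close>
    have "y * a powr (q - 1) \<le> y powr q / q + (a powr (q - 1)) powr (q / (q - 1)) / (q / (q - 1))"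
      using q real by (intro Youngs_inequality) (auto simp: field_simps)
    also have "(a powr (q - 1)) powr (q / (q - 1)) = a powr q"
      using q by (simp add: powr_powr)
    finally show ?thesis using q by (simp add: field_simps)
  qed (use assms real in auto)
  with real assms show ?thesis
    by (simp add: ennpowr_ennreal ennreal_mult[symmetric] ennreal_plus[symmetric] del: ennreal_plus)
qed (use ennpowr_top[of q] in simp)

text \<open>Jensen's inequality, by integrating the tangent inequality at the mean value.\<close>

lemma nn_integral_ennpowr_le:
  fixes q W :: real
  assumes [measurable]: "w \<in> borel_measurable M" "h \<in> borel_measurable M"
    and W: "(\<integral>\<^sup>+ x. w x \<partial>M) = ennreal W" "0 < W" and q: "1 \<le> q"
  shows "ennpowr (\<integral>\<^sup>+ x. w x * h x \<partial>M) q
    \<le> ennreal (W powr (q - 1)) * (\<integral>\<^sup>+ x. w x * ennpowr (h x) q \<partial>M)"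
proof -
  define A where "A = (\<integral>\<^sup>+ x. w x * h x \<partial>M)"
  define J where "J = (\<integral>\<^sup>+ x. w x * ennpowr (h x) q \<partial>M)"
  \<comment> \<open>The tangent point a stays free: a = 1 shows that a finite J forces a finite A,
    and the mean value a = x / W yields the claim.\<close>
  have *: "ennreal (q * a powr (q - 1)) * A \<le> J + ennreal ((q - 1) * a powr q * W)" if "a > 0" for a
  proof -
    have "ennreal (q * a powr (q - 1)) * A = (\<integral>\<^sup>+ x. w x * (ennreal (q * a powr (q - 1)) * h x) \<partial>M)"
      unfolding A_def by (subst nn_integral_cmult[symmetric]) (auto simp: mult_ac)
    also have "\<dots> \<le> (\<integral>\<^sup>+ x. w x * ennpowr (h x) q + ennreal ((q - 1) * a powr q) * w x \<partial>M)"
    proof (intro nn_integral_mono)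
      fix x
      show "w x * (ennreal (q * a powr (q - 1)) * h x) \<le> w x * ennpowr (h x) q + ennreal ((q - 1) * a powr q) * w x"
        using mult_left_mono[OF ennpowr_tangent[OF q that, of "h x"], of "w x"]
        by (simp add: distrib_left mult.commute)
    qed
    also have "\<dots> = J + ennreal ((q - 1) * a powr q) * ennreal W"
      unfolding J_def W(1)[symmetric] by (subst nn_integral_add) (auto simp: nn_integral_cmult)
    finally show ?thesis using q W(2) by (simp add: ennreal_mult)
  qed
  have "ennpowr A q \<le> ennreal (W powr (q - 1)) * J"
  proof (cases "A = 0 \<or> J = \<infinity>")
    case True
    then show ?thesis using W by (auto simp: ennpowr_def ennreal_mult_top)
  next
    case False
    have "A \<noteq> \<infinity>"
      using *[of 1] False q by (auto simp: ennreal_mult_top top_unique)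
    then obtain x j where x: "A = ennreal x" "x > 0" and j: "J = ennreal j" "0 \<le> j"
      using False by (cases A; cases J) (auto simp: less_le)
    have "q * (x / W) powr (q - 1) * x \<le> j + (q - 1) * (x / W) powr q * W"
      using *[of "x / W"] x j q W(2)
      by (simp add: ennreal_mult[symmetric] ennreal_plus[symmetric] del: ennreal_plus)
    moreover have "(x / W) powr (q - 1) * x = (x / W) powr q * W"
      using x W(2) by (simp add: powr_diff)
    ultimately have "(x / W) powr q * W \<le> j" by (simp add: algebra_simps)
    then have "x powr q \<le> W powr (q - 1) * j"
      using x W(2) by (simp add: powr_divide powr_diff field_simps)
    then show ?thesis
      using x j W(2) by (simp add: ennpowr_ennreal ennreal_mult[symmetric])
  qed
  then show ?thesis by (simp add: A_def J_def)
qed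

section \<open>Averages of dilates and the measure dt/t\<close>

lemma nn_integral_dilation:
  fixes h :: "real \<Rightarrow> ennreal"
  assumes [measurable]: "h \<in> borel_measurable borel" and "0 < c"
  shows "(\<integral>\<^sup>+ t. h (t * c) \<partial>lborel) = ennreal (1 / c) * (\<integral>\<^sup>+ t. h t \<partial>lborel)"
proof -
  have "(\<integral>\<^sup>+ t. h t \<partial>lborel) = ennreal c * (\<integral>\<^sup>+ t. h (t * c) \<partial>lborel)"
    using nn_integral_real_affine[of h c 0] assms by (simp add: mult_ac)
  then show ?thesis
    using assms by (simp add: mult.assoc[symmetric] ennreal_mult[symmetric])
qed

text \<open>This mass is the origin of the factor p/(p-1): the exponent -1/p exceeds -1 because p >
  1, so the weight is integrable at 0.\<close>

lemma nn_integral_powr_unit: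
  assumes "1 < p"
  shows "(\<integral>\<^sup>+ s. indicator {0<..1} s * ennreal (s powr (- 1 / p)) \<partial>lborel) = ennreal (p / (p - 1))"
proof -
  have "((\<lambda>x. x powr (- 1 / p)) has_integral (1 powr (- 1 / p + 1) / (- 1 / p + 1))) {0..1}"
    using assms by (intro has_integral_powr_from_0) (auto simp: field_simps)
  then have "((\<lambda>x. indicator {0..1} x * x powr (- 1 / p)) has_integral (1 / (- 1 / p + 1))) UNIV"
    by (subst (asm) has_integral_restrict_UNIV[symmetric])
       (simp add: indicator_def of_bool_def if_distrib[of "\<lambda>x. x * _"] cong: if_cong)
  from nn_integral_has_integral_lborel[OF _ _ this]
  have "(\<integral>\<^sup>+ s. ennreal (indicator {0..1} s * s powr (- 1 / p)) \<partial>lborel) = ennreal (1 / (- 1 / p + 1))"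
    by simp
  moreover have "1 / (- 1 / p + 1) = p / (p - 1)"
    using assms by (simp add: field_simps)
  moreover have "indicator {0<..1} s * ennreal (s powr (- 1 / p)) = ennreal (indicator {0..1} s * s powr (- 1 / p))"
    for s :: real
    by (auto simp: indicator_def)
  ultimately show ?thesis by simp
qed

text \<open>For a decreasing rearrangement h this is the maximal average, written with two stars in
  the overview.\<close>

definition running_mean :: "(real \<Rightarrow> ennreal) \<Rightarrow> real \<Rightarrow> ennreal"
  where "running_mean h t = ennreal (1 / t) * (\<integral>\<^sup>+ s. h s * indicator {0<..t} s \<partial>lborel)"

text \<open>Substituting t * s for s moves t from the range of integration into the argument of h;
  the mean becomes an average of dilates of h over a fixed interval, from which monotonicity in t
  can be read off.\<close>

lemma running_mean_unit:
  assumes [measurable]: "h \<in> borel_measurable borel" and "0 < t"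
  shows "running_mean h t = (\<integral>\<^sup>+ s. h (t * s) * indicator {0<..1} s \<partial>lborel)"
proof -
  have "running_mean h t = (\<integral>\<^sup>+ s. h (s * t) * indicator {0<..t} (s * t) \<partial>lborel)"
    unfolding running_mean_def using assms
    by (subst nn_integral_dilation[of "\<lambda>s. h s * indicator {0<..t} s"]) auto
  also have "\<dots> = (\<integral>\<^sup>+ s. h (t * s) * indicator {0<..1} s \<partial>lborel)"
    using assms by (intro nn_integral_cong) (auto simp: indicator_def mult_ac zero_less_mult_iff)
  finally show ?thesis .
qed

lemma running_mean_antimono:
  assumes h: "antimono h" and [measurable]: "h \<in> borel_measurable borel" and "0 < t" "t \<le> u"
  shows "running_mean h u \<le> running_mean h t"
  using assms antimonoD[OF h]
  by (auto simp: running_mean_unit indicator_def mult_right_mono intro!: nn_integral_mono)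

text \<open>With F(u) = u^(1/p) h(u), splitting t^(1/p) as s^(-1/p) (t s)^(1/p) exhibits the
  weighted mean as an average of the dilates F(t s) against the weight s^(-1/p).\<close>

lemma weighted_running_mean:
  assumes [measurable]: "h \<in> borel_measurable borel" and "0 < t" "1 < p"
  shows "ennreal (t powr (1 / p)) * running_mean h t =
    (\<integral>\<^sup>+ s. indicator {0<..1} s * ennreal (s powr (- 1 / p)) *
        (ennreal ((t * s) powr (1 / p)) * h (t * s)) \<partial>lborel)"
proof -
  have "s powr (- 1 / p) * (t * s) powr (1 / p) = t powr (1 / p)" if "0 < s" for s
    using assms that by (simp add: powr_mult powr_minus field_simps)
  then have "ennreal (t powr (1 / p)) * (h (t * s) * indicator {0<..1} s) =
    indicator {0<..1} s * ennreal (s powr (- 1 / p)) * (ennreal ((t * s) powr (1 / p)) * h (t * s))" for s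
    by (simp add: indicator_def mult.assoc[symmetric] ennreal_mult[symmetric])
  then show ?thesis
    unfolding running_mean_unit[OF assms(1,2)] by (subst nn_integral_cmult[symmetric]) auto
qed

text \<open>Since dt/t is invariant under dilations, all dilates of \<open>\<phi>\<close> have the
  same integral N. Averaging them costs only powers of the mass W of the weight: W^(q-1) from
  Jensen, and one more W from integrating the weight after Fubini.\<close>

lemma hardy_inequality:
  fixes p q :: real
  assumes [measurable]: "h \<in> borel_measurable borel" and p: "1 < p" and q: "1 \<le> q"
  shows "(\<integral>\<^sup>+ t\<in>{0<..}. ennpowr (ennreal (t powr (1 / p)) * running_mean h t) q * ennreal (1 / t) \<partial>lborel)
    \<le> ennreal ((p / (p - 1)) powr q) *
      (\<integral>\<^sup>+ t\<in>{0<..}. ennpowr (ennreal (t powr (1 / p)) * h t) q * ennreal (1 / t) \<partial>lborel)"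
proof -
  define W where "W = p / (p - 1)"
  have W: "0 < W" using p by (simp add: W_def)
  define w where "w s = indicator {0<..1} s * ennreal (s powr (- 1 / p))" for s :: real
  have [measurable]: "w \<in> borel_measurable borel" unfolding w_def by measurable
  have intw: "(\<integral>\<^sup>+ s. w s \<partial>lborel) = ennreal W"
    unfolding w_def W_def by (rule nn_integral_powr_unit[OF p])
  define \<phi> where "\<phi> u = ennpowr (ennreal (u powr (1 / p)) * h u) q" for u
  have [measurable]: "\<phi> \<in> borel_measurable borel" unfolding \<phi>_def by measurable
  define N where "N = (\<integral>\<^sup>+ t. \<phi> t * ennreal (1 / t) * indicator {0<..} t \<partial>lborel)"
  have "(\<integral>\<^sup>+ t\<in>{0<..}. ennpowr (ennreal (t powr (1 / p)) * running_mean h t) q * ennreal (1 / t) \<partial>lborel)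
    \<le> (\<integral>\<^sup>+ t. (ennreal (W powr (q - 1)) * (\<integral>\<^sup>+ s. w s * \<phi> (t * s) \<partial>lborel)) * ennreal (1 / t) * indicator {0<..} t \<partial>lborel)"
  proof (intro nn_integral_mono)
    fix t :: real
    have "ennpowr (ennreal (t powr (1 / p)) * running_mean h t) q \<le>
      ennreal (W powr (q - 1)) * (\<integral>\<^sup>+ s. w s * \<phi> (t * s) \<partial>lborel)" if "t > 0"
      unfolding weighted_running_mean[OF assms(1) that p] \<phi>_def w_def[symmetric]
      by (intro nn_integral_ennpowr_le intw W q) measurable
    then show "ennpowr (ennreal (t powr (1 / p)) * running_mean h t) q * ennreal (1 / t) * indicator {0<..} t
      \<le> (ennreal (W powr (q - 1)) * (\<integral>\<^sup>+ s. w s * \<phi> (t * s) \<partial>lborel)) * ennreal (1 / t) * indicator {0<..} t"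
      by (auto simp: indicator_def intro!: mult_right_mono)
  qed
  also have "\<dots> = (\<integral>\<^sup>+ t. (\<integral>\<^sup>+ s. ennreal (W powr (q - 1)) * w s * (\<phi> (t * s) * ennreal (1 / t) * indicator {0<..} t) \<partial>lborel) \<partial>lborel)"
    by (intro nn_integral_cong, subst mult.assoc, subst mult.assoc, subst nn_integral_multc[symmetric])
       (auto simp: nn_integral_cmult[symmetric] mult_ac nn_integral_multc[symmetric])
  also have "\<dots> = (\<integral>\<^sup>+ s. (\<integral>\<^sup>+ t. ennreal (W powr (q - 1)) * w s * (\<phi> (t * s) * ennreal (1 / t) * indicator {0<..} t) \<partial>lborel) \<partial>lborel)"
    by (rule lborel_pair.Fubini') measurable
  also have "\<dots> = (\<integral>\<^sup>+ s. ennreal (W powr (q - 1)) * w s * N \<partial>lborel)"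
  proof (intro nn_integral_cong)
    fix s :: real
    have "(\<integral>\<^sup>+ t. \<phi> (t * s) * ennreal (1 / t) * indicator {0<..} t \<partial>lborel) = N" if "s > 0"
    proof -
      have "(\<integral>\<^sup>+ t. \<phi> (t * s) * ennreal (1 / t) * indicator {0<..} t \<partial>lborel) =
        (\<integral>\<^sup>+ t. ennreal s * (\<phi> (t * s) * ennreal (1 / (t * s)) * indicator {0<..} (t * s)) \<partial>lborel)"
      proof (intro nn_integral_cong)
        fix t :: real
        have "ennreal s * ennreal (1 / (t * s)) = ennreal (1 / t)" if "t > 0"
          using that \<open>s > 0\<close> by (simp add: ennreal_mult[symmetric])
        then show "\<phi> (t * s) * ennreal (1 / t) * indicator {0<..} t =
          ennreal s * (\<phi> (t * s) * ennreal (1 / (t * s)) * indicator {0<..} (t * s))"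
          using that
          by (auto simp: indicator_def zero_less_mult_iff mult.left_commute[of "ennreal s" "\<phi> _"] simp del: ennreal_mult'')
      qed
      also have "\<dots> = ennreal s * (\<integral>\<^sup>+ t. \<phi> (t * s) * ennreal (1 / (t * s)) * indicator {0<..} (t * s) \<partial>lborel)"
        by (intro nn_integral_cmult) measurable
      also have "\<dots> = ennreal s * (ennreal (1 / s) * N)"
        unfolding N_def
        using nn_integral_dilation[of "\<lambda>t. \<phi> t * ennreal (1 / t) * indicator {0<..} t", OF _ that] by simp
      also have "\<dots> = N" using that by (simp add: mult.assoc[symmetric] ennreal_mult[symmetric])
      finally show ?thesis .
    qed
    then show "(\<integral>\<^sup>+ t. ennreal (W powr (q - 1)) * w s * (\<phi> (t * s) * ennreal (1 / t) * indicator {0<..} t) \<partial>lborel)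
      = ennreal (W powr (q - 1)) * w s * N"
      \<comment> \<open>Dilation invariance covers s > 0; for other s the weight w s is
        zero.\<close>
      by (cases "s > 0") (auto simp: nn_integral_cmult w_def)
  qed
  also have "\<dots> = ennreal (W powr (q - 1)) * ennreal W * N"
    by (simp add: nn_integral_cmult nn_integral_multc intw)
  also have "ennreal (W powr (q - 1)) * ennreal W = ennreal (W powr q)"
    using W by (simp add: ennreal_mult[symmetric] powr_diff)
  finally show ?thesis by (simp add: N_def \<phi>_def W_def)
qed

section \<open>Rearrangements\<close>

lemma borel_measurable_antimono:
  fixes f :: "real \<Rightarrow> ennreal"
  assumes "antimono f" shows "f \<in> borel_measurable borel"
proof (rule borel_measurableI_greater)
  fix y
  have "is_interval {x \<in> space borel. y < f x}"
    using antimonoD[OF assms] by (auto simp: is_interval_1 intro: less_le_trans)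
  then show "{x \<in> space borel. y < f x} \<in> sets borel"
    by (rule real_interval_borel_measurable)
qed

lemma antimono_decr_rearrangement: "antimono (decr_rearrangement \<Omega> g)"
  unfolding decr_rearrangement_def
  by (rule antimonoI, rule INF_superset_mono) (auto intro: order_trans ennreal_leI)

lemma borel_measurable_decr_rearrangement [measurable]:
  "decr_rearrangement \<Omega> g \<in> borel_measurable borel"
  by (rule borel_measurable_antimono[OF antimono_decr_rearrangement])

lemma distribution_fun_lborel:
  assumes [measurable]: "\<Omega> \<in> sets borel" "g \<in> borel_measurable borel"
  shows "distribution_fun \<Omega> g \<alpha> = emeasure lborel {x \<in> \<Omega>. norm (g x) > \<alpha>}"
proof -
  have "{x \<in> \<Omega>. norm (g x) > \<alpha>} \<in> sets lborel" by measurable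
  then show ?thesis unfolding distribution_fun_def by simp
qed

lemma antimono_distribution_fun:
  assumes [measurable]: "\<Omega> \<in> sets borel" "g \<in> borel_measurable borel"
  shows "antimono (distribution_fun \<Omega> g)"
  unfolding distribution_fun_lborel[OF assms]
  by (rule antimonoI, rule emeasure_mono) auto

lemma nn_integral_superlevel_le_decr_rearrangement:
  assumes "\<Omega> \<in> sets borel" "g \<in> borel_measurable borel"
  shows "(\<integral>\<^sup>+ \<alpha>. indicator {\<alpha>. 0 < \<alpha> \<and> ennreal s < distribution_fun \<Omega> g \<alpha>} \<alpha> \<partial>lborel)
    \<le> decr_rearrangement \<Omega> g s"
proof (cases "decr_rearrangement \<Omega> g s")
  case (real r)
  have "\<alpha> \<le> r" if "ennreal s < distribution_fun \<Omega> g \<alpha>" "0 < \<alpha>" for \<alpha>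
  proof -
    have "ennreal \<alpha> \<le> decr_rearrangement \<Omega> g s"
      unfolding decr_rearrangement_def
    proof (safe intro!: INF_greatest)
      fix \<beta> assume "distribution_fun \<Omega> g \<beta> \<le> ennreal s"
      then have "\<not> \<beta> \<le> \<alpha>"
        using antimonoD[OF antimono_distribution_fun[OF assms], of \<beta> \<alpha>] that by auto
      then show "ennreal \<alpha> \<le> ennreal \<beta>" by (intro ennreal_leI) simp
    qed
    with real show ?thesis by simp
  qed
  then have "(\<integral>\<^sup>+ \<alpha>. indicator {\<alpha>. 0 < \<alpha> \<and> ennreal s < distribution_fun \<Omega> g \<alpha>} \<alpha> \<partial>lborel)
    \<le> (\<integral>\<^sup>+ \<alpha>. indicator {0..r} \<alpha> \<partial>lborel)"
    by (intro nn_integral_mono) (auto simp: indicator_def)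
  then show ?thesis using real by simp
qed simp

text \<open>Layer cake on E: the part of a superlevel set inside E has measure at most the minimum
  of \<tau> and the distribution function d \<alpha>, and that minimum is the length of the set of s
  in (0, \<tau>] with s below d \<alpha>, up to an endpoint. Integrating over \<alpha> first then
  recovers the rearrangement at s.\<close>

lemma hardy_littlewood_decr_rearrangement:
  fixes g :: "'a::euclidean_space \<Rightarrow> 'b::euclidean_space"
  assumes [measurable]: "\<Omega> \<in> sets borel" "g \<in> borel_measurable borel" "E \<in> sets borel"
    and E: "E \<subseteq> \<Omega>" "emeasure lborel E \<le> ennreal \<tau>" and \<tau>: "0 \<le> \<tau>"
  shows "(\<integral>\<^sup>+ x. ennreal (norm (g x)) * indicator E x \<partial>lborel)
    \<le> (\<integral>\<^sup>+ s. decr_rearrangement \<Omega> g s * indicator {0<..\<tau>} s \<partial>lborel)"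
proof -
  define d where "d = distribution_fun \<Omega> g"
  have [measurable]: "d \<in> borel_measurable borel"
    unfolding d_def by (intro borel_measurable_antimono antimono_distribution_fun) measurable
  have "(\<integral>\<^sup>+ x. ennreal (norm (g x)) * indicator E x \<partial>lborel)
    = (\<integral>\<^sup>+ x. (\<integral>\<^sup>+ \<alpha>. indicator {0<..<norm (g x)} \<alpha> * indicator E x \<partial>lborel) \<partial>lborel)"
    by (intro nn_integral_cong) (simp add: nn_integral_multc)
  also have "\<dots> = (\<integral>\<^sup>+ x. (\<integral>\<^sup>+ \<alpha>. indicator {x \<in> E. \<alpha> < norm (g x)} x * indicator {0<..} \<alpha> \<partial>lborel) \<partial>lborel)"
    by (intro nn_integral_cong) (auto simp: indicator_def)
  also have "\<dots> = (\<integral>\<^sup>+ \<alpha>. (\<integral>\<^sup>+ x. indicator {x \<in> E. \<alpha> < norm (g x)} x * indicator {0<..} \<alpha> \<partial>lborel) \<partial>lborel)"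
    by (rule lborel_pair.Fubini') measurable
  also have "\<dots> \<le> (\<integral>\<^sup>+ \<alpha>. (\<integral>\<^sup>+ s. indicator {0<..\<tau>} s * indicator {\<alpha>. 0 < \<alpha> \<and> ennreal s < d \<alpha>} \<alpha> \<partial>lborel) \<partial>lborel)"
  proof (intro nn_integral_mono)
    fix \<alpha> :: real
    show "(\<integral>\<^sup>+ x. indicator {x \<in> E. \<alpha> < norm (g x)} x * indicator {0<..} \<alpha> \<partial>lborel)
      \<le> (\<integral>\<^sup>+ s. indicator {0<..\<tau>} s * indicator {\<alpha>. 0 < \<alpha> \<and> ennreal s < d \<alpha>} \<alpha> \<partial>lborel)"
    proof (cases "0 < \<alpha>")
      case True
      have "emeasure lborel {x \<in> E. \<alpha> < norm (g x)} \<le> emeasure lborel E"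
        by (intro emeasure_mono) auto
      then have 1: "emeasure lborel {x \<in> E. \<alpha> < norm (g x)} \<le> ennreal \<tau>"
        using E(2) by (rule order_trans)
      have 2: "emeasure lborel {x \<in> E. \<alpha> < norm (g x)} \<le> d \<alpha>"
        unfolding d_def distribution_fun_lborel[OF assms(1,2)]
        by (intro emeasure_mono) (use E in auto)
      obtain m where m: "emeasure lborel {x \<in> E. \<alpha> < norm (g x)} = ennreal m" "0 \<le> m" "m \<le> \<tau>"
        using 1 \<tau> by (cases "emeasure lborel {x \<in> E. \<alpha> < norm (g x)}") (auto simp: top_unique)
      have "(\<integral>\<^sup>+ x. indicator {x \<in> E. \<alpha> < norm (g x)} x * indicator {0<..} \<alpha> \<partial>lborel) = ennreal m"
        using m(1) True by simp
      also have "\<dots> = (\<integral>\<^sup>+ s. indicator {0<..<m} s \<partial>lborel)" using m by simp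
      also have "\<dots> \<le> (\<integral>\<^sup>+ s. indicator {0<..\<tau>} s * indicator {\<alpha>. 0 < \<alpha> \<and> ennreal s < d \<alpha>} \<alpha> \<partial>lborel)"
      proof (intro nn_integral_mono)
        fix s :: real
        have "ennreal s < d \<alpha>" if "0 < s" "s < m"
        proof -
          have "ennreal s < ennreal m" using that by (simp add: ennreal_less_iff)
          then show ?thesis using 2 m(1) by simp
        qed
        then show "indicator {0<..<m} s \<le> (indicator {0<..\<tau>} s * indicator {\<alpha>. 0 < \<alpha> \<and> ennreal s < d \<alpha>} \<alpha> :: ennreal)"
          using m True by (auto simp: indicator_def)
      qed
      finally show ?thesis .
    qed simp
  qed
  also have "\<dots> = (\<integral>\<^sup>+ s. (\<integral>\<^sup>+ \<alpha>. indicator {0<..\<tau>} s * indicator {\<alpha>. 0 < \<alpha> \<and> ennreal s < d \<alpha>} \<alpha> \<partial>lborel) \<partial>lborel)"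
    by (rule lborel_pair.Fubini') measurable
  also have "\<dots> \<le> (\<integral>\<^sup>+ s. decr_rearrangement \<Omega> g s * indicator {0<..\<tau>} s \<partial>lborel)"
    using nn_integral_superlevel_le_decr_rearrangement[OF assms(1,2)]
    by (intro nn_integral_mono) (auto simp: nn_integral_cmult indicator_def[of "{0<..\<tau>}"] d_def)
  finally show ?thesis .
qed

section \<open>From integral bounds on superlevel sets to Lorentz norms\<close>

lemma running_mean_mult:
  assumes "0 < t"
  shows "(\<integral>\<^sup>+ s. h s * indicator {0<..t} s \<partial>lborel) = ennreal t * running_mean h t"
  using assms by (simp add: running_mean_def mult.assoc[symmetric] ennreal_mult[symmetric])

lemma borel_measurable_running_mean [measurable]:
  assumes [measurable]: "h \<in> borel_measurable borel"
  shows "running_mean h \<in> borel_measurable borel"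
proof -
  have "running_mean h = (\<lambda>t. ennreal (1 / t) *
      (\<integral>\<^sup>+ s. h s * (if 0 < s \<and> s \<le> t then 1 else 0) \<partial>lborel))"
    by (intro ext) (simp add: running_mean_def indicator_def of_bool_def)
  then show ?thesis by simp
qed

text \<open>The hypothesis \<open>le\<close> is what Chebyshev's inequality gives on the superlevel
  set at height \<alpha>. If that set had measure \<tau> > t, dividing by \<tau> would bound
  \<alpha> by K times the mean up to \<tau>, hence by K times the larger mean up to t.\<close>

lemma decr_rearrangement_le_running_mean:
  assumes h: "antimono h" and [measurable]: "h \<in> borel_measurable borel" and "0 < t" and K: "0 \<le> K"
    and fin: "\<And>\<alpha>. distribution_fun \<Omega> u \<alpha> < \<infinity>"
    and le: "\<And>\<alpha> \<tau>. 0 < \<alpha> \<Longrightarrow> 0 < \<tau> \<Longrightarrow> distribution_fun \<Omega> u \<alpha> = ennreal \<tau> \<Longrightarrow>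
      ennreal \<alpha> * ennreal \<tau> \<le> ennreal K * (\<integral>\<^sup>+ s. h s * indicator {0<..\<tau>} s \<partial>lborel)"
  shows "decr_rearrangement \<Omega> u t \<le> ennreal K * running_mean h t"
proof (rule ennreal_le_epsilon)
  fix e :: real assume R: "ennreal K * running_mean h t < top" and "0 < e"
  then obtain r where r: "ennreal K * running_mean h t = ennreal r" "0 \<le> r"
    by (cases "ennreal K * running_mean h t") auto
  \<comment> \<open>The slack e makes the level positive even when r = 0, as the infimum requires,
    and makes the contradiction strict.\<close>
  have "distribution_fun \<Omega> u (r + e) \<le> ennreal t"
  proof (rule ccontr)
    assume *: "\<not> distribution_fun \<Omega> u (r + e) \<le> ennreal t"
    obtain \<tau> where \<tau>: "distribution_fun \<Omega> u (r + e) = ennreal \<tau>"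
      using fin[of "r + e"] by (cases "distribution_fun \<Omega> u (r + e)") auto
    then have "t < \<tau>" using * \<open>0 < t\<close> by (metis ennreal_leI not_le)
    have "ennreal (r + e) * ennreal \<tau> \<le> ennreal K * (ennreal \<tau> * running_mean h \<tau>)"
      using le[of "r + e" \<tau>] \<tau> \<open>t < \<tau>\<close> \<open>0 < t\<close> r(2) \<open>0 < e\<close> by (simp add: running_mean_mult)
    also have "\<dots> \<le> ennreal K * (ennreal \<tau> * running_mean h t)"
      using \<open>t < \<tau>\<close> \<open>0 < t\<close> by (intro mult_left_mono running_mean_antimono h) auto
    also have "\<dots> = ennreal (r * \<tau>)"
      using r \<open>t < \<tau>\<close> \<open>0 < t\<close>
      by (simp add: mult.left_commute[of "ennreal K"] ennreal_mult mult.commute[of _ "ennreal \<tau>"])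
    finally have "(r + e) * \<tau> \<le> r * \<tau>"
      using r(2) \<open>t < \<tau>\<close> \<open>0 < t\<close> \<open>0 < e\<close> by (simp add: ennreal_mult[symmetric] del: ennreal_plus)
    then show False using \<open>t < \<tau>\<close> \<open>0 < t\<close> \<open>0 < e\<close> by (simp add: distrib_right mult_le_0_iff)
  qed
  then have "decr_rearrangement \<Omega> u t \<le> ennreal (r + e)"
    unfolding decr_rearrangement_def using r(2) \<open>0 < e\<close> by (intro INF_lower) auto
  then show "decr_rearrangement \<Omega> u t \<le> ennreal K * running_mean h t + ennreal e"
    using r \<open>0 < e\<close> by simp
qed

text \<open>Both factors of the constant are visible here: K passes through by homogeneity of the
  norm, and p/(p-1) is the price of replacing the running mean by the function itself.\<close>

lemma lorentz_norm_le_running_mean: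
  fixes p K :: real and q :: ennreal
  assumes p: "1 < p" and q: "1 \<le> q" and K: "0 < K"
    and le: "\<And>t. 0 < t \<Longrightarrow> decr_rearrangement \<Omega> u t \<le> ennreal K * running_mean (decr_rearrangement \<Omega>' v) t"
  shows "lorentz_norm p q \<Omega> u \<le> ennreal (K * (p / (p - 1))) * lorentz_norm p q \<Omega>' v"
proof -
  define W where "W = p / (p - 1)"
  have W: "0 < W" using p by (simp add: W_def)
  let ?h = "decr_rearrangement \<Omega>' v"
  have le': "ennreal (t powr (1 / p)) * decr_rearrangement \<Omega> u t \<le>
     ennreal K * (ennreal (t powr (1 / p)) * running_mean ?h t)" if "0 < t" for t
    using mult_left_mono[OF le[OF that], of "ennreal (t powr (1 / p))"] by (simp add: mult.left_commute)
  show ?thesis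
  proof (cases "q = \<infinity>")
    case True
    \<comment> \<open>The endpoint form of Hardy's inequality: every dilate in the weighted average
      is at most the supremum S, and the weight has mass W.\<close>
    define S where "S = lorentz_norm p q \<Omega>' v"
    have S: "ennreal (t powr (1 / p)) * ?h t \<le> S" if "0 < t" for t
      unfolding S_def lorentz_norm_def using True that by (auto intro: SUP_upper)
    have "ennreal (t powr (1 / p)) * running_mean ?h t \<le> ennreal W * S" if "0 < t" for t
    proof -
      have "ennreal (t powr (1 / p)) * running_mean ?h t \<le>
        (\<integral>\<^sup>+ s. indicator {0<..1} s * ennreal (s powr (- 1 / p)) * S \<partial>lborel)"
        unfolding weighted_running_mean[OF borel_measurable_decr_rearrangement that p]
        using S that by (intro nn_integral_mono) (auto simp: indicator_def intro!: mult_left_mono)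
      also have "\<dots> = ennreal W * S"
        unfolding W_def nn_integral_powr_unit[OF p, symmetric] by (rule nn_integral_multc) measurable
      finally show ?thesis .
    qed
    then have "ennreal (t powr (1 / p)) * decr_rearrangement \<Omega> u t \<le> ennreal K * (ennreal W * S)" if "0 < t" for t
      using le'[OF that] that by (meson mult_left_mono order_trans zero_le)
    then have "lorentz_norm p q \<Omega> u \<le> ennreal K * (ennreal W * S)"
      unfolding lorentz_norm_def[of p q \<Omega>] using True by (auto intro!: SUP_least)
    also have "\<dots> = ennreal (K * W) * S" using K W by (simp add: ennreal_mult mult.assoc)
    finally show ?thesis by (simp add: S_def W_def)
  next
    case False
    define r where "r = enn2real q"
    have r: "1 \<le> r" using False q unfolding r_def by (cases q) (auto simp flip: ennreal_1)
    define N where "N = (\<integral>\<^sup>+ t\<in>{0<..}. ennpowr (ennreal (t powr (1 / p)) * ?h t) r * ennreal (1 / t) \<partial>lborel)"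
    have "(\<integral>\<^sup>+ t\<in>{0<..}. ennpowr (ennreal (t powr (1 / p)) * decr_rearrangement \<Omega> u t) r * ennreal (1 / t) \<partial>lborel)
      \<le> (\<integral>\<^sup>+ t. ennreal (K powr r) * (ennpowr (ennreal (t powr (1 / p)) * running_mean ?h t) r * ennreal (1 / t) * indicator {0<..} t) \<partial>lborel)"
    proof (intro nn_integral_mono)
      fix t :: real
      have "ennpowr (ennreal (t powr (1 / p)) * decr_rearrangement \<Omega> u t) r
        \<le> ennreal (K powr r) * ennpowr (ennreal (t powr (1 / p)) * running_mean ?h t) r" if "0 < t"
        unfolding ennpowr_mult_left[OF K, symmetric] using ennpowr_mono[OF le'[OF that], of r] r by simp
      then show "ennpowr (ennreal (t powr (1 / p)) * decr_rearrangement \<Omega> u t) r * ennreal (1 / t) * indicator {0<..} t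
        \<le> ennreal (K powr r) * (ennpowr (ennreal (t powr (1 / p)) * running_mean ?h t) r * ennreal (1 / t) * indicator {0<..} t)"
        by (auto simp: indicator_def mult.assoc[symmetric] intro!: mult_right_mono)
    qed
    also have "\<dots> = ennreal (K powr r) * (\<integral>\<^sup>+ t\<in>{0<..}. ennpowr (ennreal (t powr (1 / p)) * running_mean ?h t) r * ennreal (1 / t) \<partial>lborel)"
      by (intro nn_integral_cmult) measurable
    also have "\<dots> \<le> ennreal (K powr r) * (ennreal (W powr r) * N)"
      unfolding N_def W_def using p r by (intro mult_left_mono hardy_inequality) auto
    also have "\<dots> = ennreal ((K * W) powr r) * N"
      using K W by (simp add: powr_mult ennreal_mult mult.assoc)
    finally have "lorentz_norm p q \<Omega> u \<le> ennpowr (ennreal ((K * W) powr r) * N) (1 / r)"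
      unfolding lorentz_norm_def using False r by (auto simp: r_def[symmetric] intro: ennpowr_mono)
    also have "\<dots> = ennreal (K * W) * ennpowr N (1 / r)"
      using K W r by (simp add: ennpowr_mult_left powr_powr)
    finally show ?thesis
      using False by (simp add: lorentz_norm_def[of p q \<Omega>'] N_def W_def r_def)
  qed
qed

section \<open>Translations in the space of integrable functions\<close>

lemma nn_integral_affine:
  fixes t :: "'a::euclidean_space"
  assumes [measurable]: "f \<in> borel_measurable borel" and c: "0 < c"
  shows "(\<integral>\<^sup>+ x. f (t + c *\<^sub>R x) \<partial>lborel) = ennreal (1 / c ^ DIM('a)) * (\<integral>\<^sup>+ x. f x \<partial>lborel)"
proof -
  have "(\<integral>\<^sup>+ x. f x \<partial>lborel) = ennreal (c ^ DIM('a)) * (\<integral>\<^sup>+ x. f (t + c *\<^sub>R x) \<partial>lborel)"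
    using c by (subst lborel_affine[of c t])
      (simp_all add: nn_integral_density nn_integral_distr nn_integral_cmult)
  then show ?thesis
    using c by (simp add: mult.assoc[symmetric] ennreal_mult[symmetric] del: ennreal_power)
qed

lemma nn_integral_translate:
  fixes h :: "'a::euclidean_space"
  assumes "f \<in> borel_measurable borel"
  shows "(\<integral>\<^sup>+ x. f (x - h) \<partial>lborel) = (\<integral>\<^sup>+ x. f x \<partial>lborel)"
  using nn_integral_affine[OF assms, of 1 "- h"] by simp

lemma nn_integral_reflect:
  fixes t :: "'a::euclidean_space"
  assumes [measurable]: "f \<in> borel_measurable borel"
  shows "(\<integral>\<^sup>+ x. f (t - x) \<partial>lborel) = (\<integral>\<^sup>+ x. f x \<partial>lborel)"
  by (subst (2) lborel_affine[of "-1" t]) (simp_all add: nn_integral_density nn_integral_distr)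

text \<open>Regularity of Lebesgue measure gives an open superset and a closed subset; the latter
  becomes compact after cutting with a large ball, whose complement carries little of the finite
  measure of A. Each of the three errors is below e/3.\<close>

lemma inner_compact_outer_open:
  fixes A :: "'a::euclidean_space set" and e :: real
  assumes A: "A \<in> sets borel" and fin: "emeasure lborel A < \<infinity>" and e: "0 < e"
  obtains K U where "compact K" "open U" "K \<subseteq> A" "A \<subseteq> U" "emeasure lborel (U - K) < ennreal e"
proof -
  have AL: "A \<in> sets lebesgue" using A by simp
  have e3: "0 < e / 3" using e by simp
  obtain U where U: "open U" "A \<subseteq> U" "emeasure lebesgue (U - A) < ennreal (e / 3)"
    using sets_lebesgue_outer_open[OF AL e3] by metis
  obtain T where T: "closed T" "T \<subseteq> A" "emeasure lebesgue (A - T) < ennreal (e / 3)"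
    using sets_lebesgue_inner_closed[OF AL e3] by metis
  have "(\<lambda>n. emeasure lborel (A - cball 0 (real n))) \<longlonglongrightarrow> emeasure lborel (\<Inter>n. A - cball 0 (real n))"
  proof (rule Lim_emeasure_decseq)
    show "emeasure lborel (A - cball 0 (real n)) \<noteq> \<infinity>" for n
      using emeasure_mono[of "A - cball 0 (real n)" A lborel] A fin by (auto simp: top_unique)
  qed (use A in \<open>auto simp: decseq_def\<close>)
  moreover have "(\<Inter>n. A - cball 0 (real n)) = {}"
  proof -
    have "\<exists>n. x \<in> cball 0 (real n)" for x :: 'a
      using real_arch_simple[of "norm x"] by simp
    then show ?thesis by blast
  qed
  ultimately have "(\<lambda>n. emeasure lborel (A - cball 0 (real n))) \<longlonglongrightarrow> 0" by (simp only: emeasure_empty)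
  moreover have "0 < ennreal (e / 3)" using e by simp
  ultimately have "eventually (\<lambda>n. emeasure lborel (A - cball 0 (real n)) < ennreal (e / 3)) sequentially"
    by (rule order_tendstoD(2))
  then obtain n where n: "emeasure lborel (A - cball 0 (real n)) < ennreal (e / 3)"
    by (auto simp: eventually_sequentially)
  define K where "K = T \<inter> cball 0 (real n)"
  have [measurable]: "U \<in> sets borel" "T \<in> sets borel" "A \<in> sets borel" using U T A by auto
  have K: "compact K" unfolding K_def using T(1) by (intro closed_Int_compact) auto
  have "emeasure lborel (U - K) \<le> emeasure lborel (U - A \<union> (A - T) \<union> (A - cball 0 (real n)))"
    using T(2) U(2) by (intro emeasure_mono) (auto simp: K_def)
  also have "\<dots> \<le> emeasure lborel (U - A) + emeasure lborel (A - T) + emeasure lborel (A - cball 0 (real n))"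
    by (rule order_trans[OF emeasure_subadditive add_right_mono[OF emeasure_subadditive]]) auto
  also have "\<dots> < ennreal (e / 3) + ennreal (e / 3) + ennreal (e / 3)"
    using n U(3) T(3) by (intro add_strict_mono) auto
  also have "\<dots> = ennreal e" using e by (simp flip: ennreal_plus)
  finally show thesis using that[OF K U(1) _ U(2)] T(2) by (auto simp: K_def)
qed

text \<open>A shift shorter than \<delta> cannot carry a point of K out of U. So where the two
  indicators differ, x or x - h lies in the thin layer U - K.\<close>

lemma indicator_translate_small:
  fixes A :: "'a::euclidean_space set" and e :: real
  assumes A: "A \<in> sets borel" and fin: "emeasure lborel A < \<infinity>" and e: "0 < e"
  shows "\<exists>\<delta>>0. \<forall>h. norm h < \<delta> \<longrightarrow>
    (\<integral>\<^sup>+ x. ennreal \<bar>indicator A (x - h) - indicator A x\<bar> \<partial>lborel) \<le> ennreal e"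
proof -
  obtain K U where K: "compact K" "open U" "K \<subseteq> A" "A \<subseteq> U" "emeasure lborel (U - K) < ennreal (e / 2)"
    using inner_compact_outer_open[OF A fin, of "e / 2"] e by auto
  obtain \<delta> where \<delta>: "\<delta> > 0" "(\<Union>x\<in>K. ball x \<delta>) \<subseteq> U"
    using compact_subset_open_imp_ball_epsilon_subset[of K U] K by auto
  have [measurable]: "K \<in> sets borel" "U \<in> sets borel"
    using K by (auto intro: borel_compact)
  have "(\<integral>\<^sup>+ x. ennreal \<bar>indicator A (x - h) - indicator A x\<bar> \<partial>lborel) \<le> ennreal e" if h: "norm h < \<delta>" for h
  proof -
    have *: "ennreal \<bar>indicator A (x - h) - indicator A x\<bar> \<le> indicator (U - K) x + indicator (U - K) (x - h)" for x
    proof -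
      have "x - h \<in> U" if "x \<in> K"
        using \<delta>(2) h that by (force simp: dist_norm)
      moreover have "x \<in> U" if "x - h \<in> K"
        using \<delta>(2) h that by (force simp: dist_norm)
      ultimately show ?thesis using K by (auto simp: indicator_def)
    qed
    have "(\<integral>\<^sup>+ x. ennreal \<bar>indicator A (x - h) - indicator A x\<bar> \<partial>lborel)
      \<le> (\<integral>\<^sup>+ x. indicator (U - K) x + indicator (U - K) (x - h) \<partial>lborel)"
      by (intro nn_integral_mono *)
    also have "\<dots> = emeasure lborel (U - K) + emeasure lborel (U - K)"
      by (subst nn_integral_add) (auto simp: nn_integral_translate)
    also have "\<dots> \<le> ennreal (e / 2) + ennreal (e / 2)"
      using K(5) by (intro add_mono) auto
    also have "\<dots> = ennreal e" using e by (simp flip: ennreal_plus)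
    finally show ?thesis .
  qed
  with \<delta>(1) show ?thesis by blast
qed

text \<open>Density argument: the property holds for indicators and survives sums and L^1 limits. In
  the limit case the outer two of three error terms agree, because the integral is translation
  invariant.\<close>

lemma translation_continuous_L1:
  fixes f :: "'a::euclidean_space \<Rightarrow> real"
  assumes "integrable lborel f" and "0 < e"
  shows "\<exists>\<delta>>0. \<forall>h. norm h < \<delta> \<longrightarrow> (\<integral>\<^sup>+ x. ennreal \<bar>f (x - h) - f x\<bar> \<partial>lborel) \<le> ennreal e"
  using assms
proof (induction arbitrary: e rule: integrable_induct)
  case (base A c)
  \<comment> \<open>The added 1 keeps the quotient meaningful for c = 0.\<close>
  have "0 < e / (\<bar>c\<bar> + 1)" using base by (simp add: field_simps)
  from indicator_translate_small[OF _ _ this, of A] base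
  obtain \<delta> where \<delta>: "\<delta> > 0" "\<And>h. norm h < \<delta> \<Longrightarrow>
    (\<integral>\<^sup>+ x. ennreal \<bar>indicator A (x - h) - indicator A x\<bar> \<partial>lborel) \<le> ennreal (e / (\<bar>c\<bar> + 1))"
    by auto
  have [measurable]: "A \<in> sets borel" using base by simp
  have "(\<integral>\<^sup>+ x. ennreal \<bar>indicator A (x - h) *\<^sub>R c - indicator A x *\<^sub>R c\<bar> \<partial>lborel) \<le> ennreal e"
    if "norm h < \<delta>" for h
  proof -
    have "(\<integral>\<^sup>+ x. ennreal \<bar>indicator A (x - h) *\<^sub>R c - indicator A x *\<^sub>R c\<bar> \<partial>lborel)
      = (\<integral>\<^sup>+ x. ennreal \<bar>c\<bar> * ennreal \<bar>indicator A (x - h) - indicator A x\<bar> \<partial>lborel)"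
      by (intro nn_integral_cong)
         (simp add: ennreal_mult[symmetric] abs_mult[symmetric] right_diff_distrib mult.commute)
    also have "\<dots> = ennreal \<bar>c\<bar> * (\<integral>\<^sup>+ x. ennreal \<bar>indicator A (x - h) - indicator A x\<bar> \<partial>lborel)"
      by (intro nn_integral_cmult) measurable
    also have "\<dots> \<le> ennreal \<bar>c\<bar> * ennreal (e / (\<bar>c\<bar> + 1))"
      using \<delta>(2)[OF that] by (intro mult_left_mono) auto
    also have "\<dots> \<le> ennreal e"
      using base by (simp add: ennreal_mult[symmetric] field_simps)
    finally show ?thesis .
  qed
  with \<delta>(1) show ?case by blast
next
  case (add f g)
  then have e: "0 < e / 2" by simp
  obtain \<delta>1 where 1: "\<delta>1 > 0" "\<And>h. norm h < \<delta>1 \<Longrightarrow> (\<integral>\<^sup>+ x. ennreal \<bar>f (x - h) - f x\<bar> \<partial>lborel) \<le> ennreal (e / 2)"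
    using add.IH(1)[OF e] by auto
  obtain \<delta>2 where 2: "\<delta>2 > 0" "\<And>h. norm h < \<delta>2 \<Longrightarrow> (\<integral>\<^sup>+ x. ennreal \<bar>g (x - h) - g x\<bar> \<partial>lborel) \<le> ennreal (e / 2)"
    using add.IH(2)[OF e] by auto
  have [measurable]: "f \<in> borel_measurable borel" "g \<in> borel_measurable borel" using add.hyps by auto
  have "(\<integral>\<^sup>+ x. ennreal \<bar>f (x - h) + g (x - h) - (f x + g x)\<bar> \<partial>lborel) \<le> ennreal e"
    if "norm h < min \<delta>1 \<delta>2" for h
  proof -
    have "(\<integral>\<^sup>+ x. ennreal \<bar>f (x - h) + g (x - h) - (f x + g x)\<bar> \<partial>lborel)
      \<le> (\<integral>\<^sup>+ x. ennreal \<bar>f (x - h) - f x\<bar> + ennreal \<bar>g (x - h) - g x\<bar> \<partial>lborel)"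
      by (intro nn_integral_mono) (auto simp: ennreal_plus[symmetric] simp del: ennreal_plus intro!: ennreal_leI)
    also have "\<dots> = (\<integral>\<^sup>+ x. ennreal \<bar>f (x - h) - f x\<bar> \<partial>lborel) + (\<integral>\<^sup>+ x. ennreal \<bar>g (x - h) - g x\<bar> \<partial>lborel)"
      by (intro nn_integral_add) measurable
    also have "\<dots> \<le> ennreal (e / 2) + ennreal (e / 2)"
      using that 1(2) 2(2) by (intro add_mono) auto
    also have "\<dots> = ennreal e" using e by (simp flip: ennreal_plus)
    finally show ?thesis .
  qed
  with 1(1) 2(1) show ?case by (intro exI[of _ "min \<delta>1 \<delta>2"]) auto
next
  case (lim f s)
  then have e: "0 < e / 3" by simp
  have [measurable]: "f \<in> borel_measurable borel" "\<And>i. s i \<in> borel_measurable borel" using lim.hyps by auto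
  have "(\<lambda>i. \<integral>\<^sup>+ x. norm (f x - s i x) \<partial>lborel) \<longlonglongrightarrow> 0"
  proof (rule nn_integral_dominated_convergence_norm[where w="\<lambda>x. 2 * norm (f x)"])
    show "AE x in lborel. norm (s i x) \<le> 2 * norm (f x)" for i
      using lim.hyps(3) by auto
    show "(\<integral>\<^sup>+ x. ennreal (2 * norm (f x)) \<partial>lborel) < \<infinity>"
      using lim.hyps(4) by (auto simp: integrable_iff_bounded ennreal_mult nn_integral_cmult ennreal_mult_less_top)
    show "AE x in lborel. (\<lambda>i. s i x) \<longlonglongrightarrow> f x" using lim.hyps(2) by auto
  qed auto
  then have "eventually (\<lambda>i. (\<integral>\<^sup>+ x. norm (f x - s i x) \<partial>lborel) < ennreal (e / 3)) sequentially"
    using e by (auto intro: order_tendstoD(2))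
  then obtain i where i: "(\<integral>\<^sup>+ x. norm (f x - s i x) \<partial>lborel) < ennreal (e / 3)"
    by (auto simp: eventually_sequentially)
  obtain \<delta> where \<delta>: "\<delta> > 0" "\<And>h. norm h < \<delta> \<Longrightarrow> (\<integral>\<^sup>+ x. ennreal \<bar>s i (x - h) - s i x\<bar> \<partial>lborel) \<le> ennreal (e / 3)"
    using lim.IH[OF e] by auto
  have "(\<integral>\<^sup>+ x. ennreal \<bar>f (x - h) - f x\<bar> \<partial>lborel) \<le> ennreal e" if "norm h < \<delta>" for h
  proof -
    have "(\<integral>\<^sup>+ x. ennreal \<bar>f (x - h) - f x\<bar> \<partial>lborel)
      \<le> (\<integral>\<^sup>+ x. ennreal (norm (f (x - h) - s i (x - h))) + (ennreal \<bar>s i (x - h) - s i x\<bar> + ennreal (norm (f x - s i x))) \<partial>lborel)"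
      by (intro nn_integral_mono) (auto simp: ennreal_plus[symmetric] simp del: ennreal_plus intro!: ennreal_leI)
    also have "\<dots> = (\<integral>\<^sup>+ x. norm (f (x - h) - s i (x - h)) \<partial>lborel) +
       ((\<integral>\<^sup>+ x. ennreal \<bar>s i (x - h) - s i x\<bar> \<partial>lborel) + (\<integral>\<^sup>+ x. norm (f x - s i x) \<partial>lborel))"
      by (subst nn_integral_add, measurable, subst nn_integral_add, auto)
    also have "(\<integral>\<^sup>+ x. norm (f (x - h) - s i (x - h)) \<partial>lborel) = (\<integral>\<^sup>+ x. norm (f x - s i x) \<partial>lborel)"
      by (rule nn_integral_translate[of "\<lambda>x. ennreal (norm (f x - s i x))"]) measurable
    also have "(\<integral>\<^sup>+ x. norm (f x - s i x) \<partial>lborel) +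
       ((\<integral>\<^sup>+ x. ennreal \<bar>s i (x - h) - s i x\<bar> \<partial>lborel) + (\<integral>\<^sup>+ x. norm (f x - s i x) \<partial>lborel))
       \<le> ennreal (e / 3) + (ennreal (e / 3) + ennreal (e / 3))"
      using i \<delta>(2)[OF that] by (intro add_mono) auto
    also have "\<dots> = ennreal e" using e by (simp flip: ennreal_plus)
    finally show ?thesis .
  qed
  with \<delta>(1) show ?case by blast
qed

section \<open>Smooth bump functions\<close>

text \<open>The index j makes the family closed under differentiation up to linear combinations:
  each derivative of exp(-1/t) only produces further powers of 1/t.\<close>

definition flat_exp :: "nat \<Rightarrow> real \<Rightarrow> real"
  where "flat_exp j t = (if 0 < t then inverse t ^ j * exp (- inverse t) else 0)"

lemma flat_exp_nonneg: "0 \<le> flat_exp j t"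
  by (simp add: flat_exp_def)

text \<open>With y = 1/t the case j = 2 is exp(y) >= y^2 / 2, from the quadratic Taylor bound. This
  index is the one that occurs in the gradient of the bump.\<close>

lemma flat_exp_le:
  "flat_exp 0 t \<le> 1" "flat_exp 2 t \<le> 2"
proof -
  have "y\<^sup>2 * exp (- y) \<le> 2" if "0 < y" for y :: real
    using exp_lower_Taylor_quadratic[of y] that by (simp add: exp_minus field_simps)
  from this[of "inverse t"] show "flat_exp 0 t \<le> 1" "flat_exp 2 t \<le> 2"
    by (auto simp: flat_exp_def)
qed

lemma flat_exp_tendsto_0: "(flat_exp j \<longlongrightarrow> 0) (at 0)"
proof -
  have "((\<lambda>t::real. inverse t ^ j / exp (inverse t)) \<longlongrightarrow> 0) (at_right 0)"
    by (rule filterlim_compose[OF tendsto_power_div_exp_0 filterlim_inverse_at_top_right])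
  moreover have "\<forall>\<^sub>F t in at_right 0. inverse t ^ j / exp (inverse t) = flat_exp j t"
    by (simp add: eventually_at_filter flat_exp_def exp_minus divide_inverse)
  ultimately have "(flat_exp j \<longlongrightarrow> 0) (at_right 0)"
    by (rule Lim_transform_eventually)
  moreover have "(flat_exp j \<longlongrightarrow> 0) (at_left 0)"
    by (rule Lim_transform_eventually[OF tendsto_const])
       (simp add: flat_exp_def eventually_at_filter)
  ultimately show ?thesis by (simp add: filterlim_at_split)
qed

lemma flat_exp_has_derivative:
  "(flat_exp j has_real_derivative flat_exp (j + 2) t - real j * flat_exp (j + 1) t) (at t)"
proof -
  consider "0 < t" | "t < 0" | "t = 0" by linarith
  then show ?thesis
  proof cases
    case 1
    have D: "((\<lambda>t. inverse t ^ j * exp (- inverse t)) has_real_derivative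
      inverse t ^ j * (exp (- inverse t) * (inverse t)\<^sup>2) -
      real j * inverse t ^ (j - 1) * (inverse t)\<^sup>2 * exp (- inverse t)) (at t)"
      using 1 by (auto intro!: derivative_eq_intros simp: power2_eq_square algebra_simps)
    have eq: "real j * inverse t ^ (j - 1) * (inverse t)\<^sup>2 = real j * inverse t ^ (j + 1)"
      by (cases j) (simp_all add: power2_eq_square mult_ac)
    have "((\<lambda>t. inverse t ^ j * exp (- inverse t)) has_real_derivative
      flat_exp (j + 2) t - real j * flat_exp (j + 1) t) (at t)"
      using D[unfolded eq] 1 by (simp add: flat_exp_def power_add power2_eq_square mult_ac)
    then show ?thesis
      by (rule has_field_derivative_transform_within_open[of _ _ _ "{0<..}"])
         (use 1 in \<open>auto simp: flat_exp_def\<close>)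
  next
    case 2
    have "((\<lambda>t. 0) has_real_derivative 0) (at t)" by simp
    then have "(flat_exp j has_real_derivative 0) (at t)"
      by (rule has_field_derivative_transform_within_open[of _ _ _ "{..<0}"])
         (use 2 in \<open>auto simp: flat_exp_def\<close>)
    then show ?thesis using 2 by (simp add: flat_exp_def)
  next
    case 3
    \<comment> \<open>At the origin the difference quotient is exactly the next member of the
      family, and every member tends to 0 there.\<close>
    have "(flat_exp j (0 + h) - flat_exp j 0) / h = flat_exp (j + 1) h" for h
      by (simp add: flat_exp_def divide_inverse mult_ac)
    then have "(flat_exp j has_real_derivative 0) (at 0)"
      using flat_exp_tendsto_0[of "j + 1"] by (simp add: DERIV_def)
    then show ?thesis using 3 by (simp add: flat_exp_def)
  qed
qed

lemma continuous_on_flat_exp [continuous_intros]: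
  assumes "continuous_on S g" shows "continuous_on S (\<lambda>x. flat_exp j (g x))"
proof -
  have "continuous_on UNIV (flat_exp j)"
    using flat_exp_has_derivative by (rule DERIV_continuous_on[OF has_field_derivative_at_within])
  from continuous_on_compose2[OF this assms] show ?thesis by simp
qed

lemma borel_measurable_flat_exp [measurable]: "flat_exp j \<in> borel_measurable borel"
  by (intro borel_measurable_continuous_onI continuous_intros)

text \<open>A family of functions that contains the bump function and is closed under partial
  derivatives; all its members are therefore smooth.\<close>

inductive_set bumps :: "real \<Rightarrow> 'a::euclidean_space \<Rightarrow> ('a \<Rightarrow> real) set" for R c where
  base: "(\<lambda>z. flat_exp j (R - (z - c) \<bullet> (z - c))) \<in> bumps R c"
| inner: "g \<in> bumps R c \<Longrightarrow> (\<lambda>z. ((z - c) \<bullet> b) * g z) \<in> bumps R c"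
| scale: "g \<in> bumps R c \<Longrightarrow> (\<lambda>z. l * g z) \<in> bumps R c"
| add: "g \<in> bumps R c \<Longrightarrow> h \<in> bumps R c \<Longrightarrow> (\<lambda>z. g z + h z) \<in> bumps R c"

lemma flat_exp_bump_has_derivative:
  fixes c z :: "'a::euclidean_space"
  shows "((\<lambda>z. flat_exp j (R - (z - c) \<bullet> (z - c))) has_derivative
    (\<lambda>b. (flat_exp (j + 2) (R - (z - c) \<bullet> (z - c)) - real j * flat_exp (j + 1) (R - (z - c) \<bullet> (z - c)))
       * (- 2 * ((z - c) \<bullet> b)))) (at z)"
proof -
  have "((\<lambda>z. R - (z - c) \<bullet> (z - c)) has_derivative (\<lambda>b. - 2 * ((z - c) \<bullet> b))) (at z)"
    by (auto intro!: derivative_eq_intros simp: inner_commute)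
  from has_derivative_compose[OF this
      flat_exp_has_derivative[unfolded has_field_derivative_def, of j "R - (z - c) \<bullet> (z - c)"]]
  show ?thesis by simp
qed

lemma bumps_has_derivative:
  assumes "g \<in> bumps R c"
  shows "\<exists>D. (\<forall>x. (g has_derivative D x) (at x)) \<and> (\<forall>b. (\<lambda>x. D x b) \<in> bumps R c)"
  using assms
proof induction
  case (base j)
  let ?F = "\<lambda>j z. flat_exp j (R - (z - c) \<bullet> (z - c))"
  have "(\<lambda>x. (?F (j + 2) x - real j * ?F (j + 1) x) * (- 2 * ((x - c) \<bullet> b))) \<in> bumps R c" for b
  proof -
    have "(\<lambda>x. - 2 * (((x - c) \<bullet> b) * (?F (j + 2) x + (- real j) * ?F (j + 1) x))) \<in> bumps R c"
      by (intro bumps.intros)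
    then show ?thesis by (simp add: algebra_simps)
  qed
  then show ?case
    using flat_exp_bump_has_derivative[of j R c]
    by (intro exI[of _ "\<lambda>x b. (?F (j + 2) x - real j * ?F (j + 1) x) * (- 2 * ((x - c) \<bullet> b))"]) auto
next
  case (inner g b)
  then obtain D where D: "\<And>x. (g has_derivative D x) (at x)" "\<And>b. (\<lambda>x. D x b) \<in> bumps R c" by blast
  have "((\<lambda>z. ((z - c) \<bullet> b) * g z) has_derivative (\<lambda>v. (v \<bullet> b) * g x + ((x - c) \<bullet> b) * D x v)) (at x)" for x
    by (auto intro!: derivative_eq_intros D(1))
  moreover have "(\<lambda>x. (v \<bullet> b) * g x + ((x - c) \<bullet> b) * D x v) \<in> bumps R c" for v
    by (intro bumps.intros inner D)
  ultimately show ?case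
    by (intro exI[of _ "\<lambda>x v. (v \<bullet> b) * g x + ((x - c) \<bullet> b) * D x v"]) auto
next
  case (scale g l)
  then obtain D where D: "\<And>x. (g has_derivative D x) (at x)" "\<And>b. (\<lambda>x. D x b) \<in> bumps R c" by blast
  have "((\<lambda>z. l * g z) has_derivative (\<lambda>v. l * D x v)) (at x)" for x
    by (auto intro!: derivative_eq_intros D(1))
  moreover have "(\<lambda>x. l * D x v) \<in> bumps R c" for v
    by (intro bumps.intros D)
  ultimately show ?case by (intro exI[of _ "\<lambda>x v. l * D x v"]) auto
next
  case (add g h)
  then obtain D D' where D: "\<And>x. (g has_derivative D x) (at x)" "\<And>b. (\<lambda>x. D x b) \<in> bumps R c"
    "\<And>x. (h has_derivative D' x) (at x)" "\<And>b. (\<lambda>x. D' x b) \<in> bumps R c" by blast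
  have "((\<lambda>z. g z + h z) has_derivative (\<lambda>v. D x v + D' x v)) (at x)" for x
    by (auto intro!: derivative_eq_intros D)
  moreover have "(\<lambda>x. D x v + D' x v) \<in> bumps R c" for v
    by (intro bumps.intros D)
  ultimately show ?case by (intro exI[of _ "\<lambda>x v. D x v + D' x v"]) auto
qed

lemma bumps_Ck: "g \<in> bumps R c \<Longrightarrow> Ck k g"
proof (induction k arbitrary: g)
  case 0
  then show ?case
    using bumps_has_derivative[OF 0] by (auto intro: has_derivative_continuous_on has_derivative_at_withinI)
next
  case (Suc k)
  obtain D where D: "\<And>x. (g has_derivative D x) (at x)" "\<And>b. (\<lambda>x. D x b) \<in> bumps R c"
    using bumps_has_derivative[OF Suc.prems] by blast
  have "frechet_derivative g (at x) = D x" for x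
    using frechet_derivative_at[OF D(1)] by simp
  then show ?case using Suc.IH[OF D(2)] D(1) by (auto simp: differentiable_def)
qed

text \<open>The standard mollifying kernel exp(-1/(e^2 - |z|^2)), without normalisation. Squared
  norms keep the argument of \<open>flat_exp\<close> polynomial, so the function belongs to
  \<open>bumps\<close>.\<close>

definition bump :: "real \<Rightarrow> 'a::euclidean_space \<Rightarrow> real"
  where "bump e z = flat_exp 0 (e\<^sup>2 - z \<bullet> z)"

lemma bump_nonneg: "0 \<le> bump e z" and bump_le_1: "bump e z \<le> 1"
  by (auto simp: bump_def flat_exp_nonneg flat_exp_le)

lemma bump_commute: "bump e (x - z) = bump e (z - x)"
  by (simp add: bump_def inner_diff inner_commute algebra_simps)

lemma borel_measurable_bump [measurable]: "bump e \<in> borel_measurable borel"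
  unfolding bump_def by measurable

lemma bump_eq_0_iff:
  assumes "0 < e" shows "bump e z = 0 \<longleftrightarrow> e \<le> norm z"
proof -
  have "z \<bullet> z < e\<^sup>2 \<longleftrightarrow> norm z < e"
    using assms by (simp add: norm_lt_square)
  then show ?thesis by (auto simp: bump_def flat_exp_def)
qed

lemma bump_has_derivative:
  "((\<lambda>z. bump e (x - z)) has_derivative (\<lambda>b. flat_exp 2 (e\<^sup>2 - (z - x) \<bullet> (z - x)) * (- 2 * ((z - x) \<bullet> b)))) (at z)"
  using flat_exp_bump_has_derivative[of 0 "e\<^sup>2" x z] unfolding bump_commute[of e x]
  by (simp add: bump_def numeral_2_eq_2)

lemma bump_test_function:
  assumes "0 < e" "cball x e \<subseteq> \<Omega>"
  shows "(\<lambda>z. bump e (x - z)) \<in> test_functions \<Omega>"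
proof -
  have "(\<lambda>z. bump e (x - z)) \<in> bumps (e\<^sup>2) x"
    unfolding bump_commute[of e x] unfolding bump_def by (rule bumps.base)
  moreover have "{z. bump e (x - z) \<noteq> 0} = ball x e"
    using assms by (auto simp: bump_eq_0_iff dist_norm)
  ultimately show ?thesis
    using assms bumps_Ck by (auto simp: test_functions_def)
qed

text \<open>The kernel is at most the indicator of its ball, hence has finite mass; it is nonzero
  throughout a ball of positive measure, hence the mass is not 0 and can later be cancelled.\<close>

lemma nn_integral_bump:
  fixes e :: real
  assumes "0 < e"
  obtains N where "0 < N" "(\<integral>\<^sup>+ z. ennreal (bump e (z::'a::euclidean_space)) \<partial>lborel) = ennreal N"
proof -
  let ?I = "\<integral>\<^sup>+ z. ennreal (bump e (z::'a)) \<partial>lborel"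
  have "?I \<le> (\<integral>\<^sup>+ z. indicator (ball (0::'a) e) z \<partial>lborel)"
  proof (intro nn_integral_mono)
    fix z :: 'a
    show "ennreal (bump e z) \<le> indicator (ball 0 e) z"
      using bump_le_1[of e z] bump_eq_0_iff[OF assms, of z] by (cases "e \<le> norm z") auto
  qed
  also have "\<dots> < \<infinity>" using emeasure_lborel_ball_finite[of "0::'a" e] by simp
  finally have fin: "?I < \<infinity>" .
  have "?I \<noteq> 0"
  proof
    assume "?I = 0"
    then have "AE z in lborel. bump e (z::'a) = 0"
      using bump_nonneg[of e, where 'a='a] by (subst (asm) nn_integral_0_iff_AE) (auto simp: ennreal_eq_0_iff antisym)
    then have "AE z in lborel. z \<notin> ball (0::'a) e"
      using bump_eq_0_iff[OF assms, where 'a='a] by (auto elim!: eventually_mono)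
    then have "emeasure lborel (ball (0::'a) e) = 0"
      by (subst (asm) AE_iff_measurable[of "ball 0 e"]) auto
    then show False
      using emeasure_lborel_ball_finite[of "0::'a" e] content_ball_pos[OF assms, of "0::'a"]
      by (simp add: measure_def)
  qed
  with fin show thesis
    by (cases ?I) (auto intro!: that simp: less_le)
qed

section \<open>Mollification along segments\<close>

lemma ennreal_norm_integral_le:
  fixes f :: "'a \<Rightarrow> 'b::{banach, second_countable_topology}"
  shows "ennreal (norm (integral\<^sup>L M f)) \<le> (\<integral>\<^sup>+ x. ennreal (norm (f x)) \<partial>M)"
  by (cases "integrable M f") (simp_all add: integral_norm_bound_ennreal not_integrable_integral_eq)

definition mollify :: "real \<Rightarrow> ('a::euclidean_space \<Rightarrow> real) \<Rightarrow> 'a \<Rightarrow> real"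
  where "mollify e f x = (LINT z|lborel. f z * bump e (x - z))"

text \<open>The derivative of \<open>bump e (x - z)\<close> in the variable z, in direction b. The
  index 2 is the derivative of \<open>flat_exp 0\<close>, and the factor -2 comes from the squared
  norm.\<close>

definition bump_slope :: "real \<Rightarrow> 'a::euclidean_space \<Rightarrow> 'a \<Rightarrow> 'a \<Rightarrow> real"
  where "bump_slope e x z b = flat_exp 2 (e\<^sup>2 - (z - x) \<bullet> (z - x)) * (- 2 * ((z - x) \<bullet> b))"

lemma frechet_derivative_bump:
  "frechet_derivative (\<lambda>z. bump e (x - z)) (at z) = bump_slope e x z"
  using frechet_derivative_at[OF bump_has_derivative[of e x z]] by (simp add: bump_slope_def fun_eq_iff)

text \<open>The constant 4 combines the bound 2 on \<open>flat_exp 2\<close> with the factor 2 from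
  the squared norm. Being uniform in x and z, the bound makes the product with an integrable
  function integrable.\<close>

lemma bump_slope_bound:
  assumes "0 < e" shows "\<bar>bump_slope e x z b\<bar> \<le> 4 * e * norm b"
proof (cases "norm (z - x) < e")
  case True
  have "\<bar>(z - x) \<bullet> b\<bar> \<le> e * norm b"
    using Cauchy_Schwarz_ineq2[of "z - x" b] mult_right_mono[of "norm (z - x)" e "norm b"] True by simp
  then have "\<bar>flat_exp 2 (e\<^sup>2 - (z - x) \<bullet> (z - x))\<bar> * \<bar>- 2 * ((z - x) \<bullet> b)\<bar> \<le> 2 * (2 * (e * norm b))"
    using flat_exp_le(2) flat_exp_nonneg by (intro mult_mono) (auto simp: abs_mult)
  then show ?thesis by (simp add: bump_slope_def abs_mult)
next
  case False
  then show ?thesis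
    using assms by (simp add: bump_slope_def flat_exp_def norm_lt_square)
qed

lemma borel_measurable_bump_slope [measurable]:
  assumes [measurable]: "f \<in> borel_measurable M" "g \<in> borel_measurable M"
  shows "(\<lambda>w. bump_slope e (f w) (g w) b) \<in> borel_measurable M"
  unfolding bump_slope_def by measurable

text \<open>Linearity in the direction, used to pass from basis vectors, where the weak gradient is
  tested, to the direction of an arbitrary segment.\<close>

lemma bump_slope_sum: "bump_slope e x z b = (\<Sum>i\<in>Basis. (b \<bullet> i) * bump_slope e x z i)"
proof -
  define c where "c = - 2 * flat_exp 2 (e\<^sup>2 - (z - x) \<bullet> (z - x))"
  have slope: "bump_slope e x z v = c * ((z - x) \<bullet> v)" for v
    by (simp add: bump_slope_def c_def)
  have "bump_slope e x z b = (\<Sum>i\<in>Basis. c * (((z - x) \<bullet> i) * (b \<bullet> i)))"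
    unfolding slope euclidean_inner[of "z - x" b] by (rule sum_distrib_left)
  then show ?thesis by (simp only: slope mult.commute mult.left_commute)
qed

text \<open>The fundamental theorem of calculus is applied to the kernel rather than to the
  mollification. The minus sign appears because the segment moves the centre while
  \<open>bump_slope\<close> differentiates in the other variable.\<close>

lemma bump_segment:
  "bump e (v - z) - bump e (u - z) =
    (LINT s|lborel. indicator {0..1} s * - bump_slope e (u + s *\<^sub>R (v - u)) z (v - u))"
proof -
  have "((\<lambda>s. bump e (u + s *\<^sub>R (v - u) - z)) has_vector_derivative
      - bump_slope e (u + s *\<^sub>R (v - u)) z (v - u)) (at s within {0..1})" for s
  proof -
    \<comment> \<open>The moving point is replaced by its reflection in z, so that the kernel is
      differentiated in the variable covered by \<open>bump_has_derivative\<close>.\<close>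
    have 1: "((\<lambda>s. z - (u + s *\<^sub>R (v - u) - z)) has_derivative (\<lambda>t. - t *\<^sub>R (v - u))) (at s within {0..1})"
      by (auto intro!: derivative_eq_intros)
    have "((\<lambda>s. bump e (z - (z - (u + s *\<^sub>R (v - u) - z)))) has_derivative
      (\<lambda>t. bump_slope e z (z - (u + s *\<^sub>R (v - u) - z)) (- t *\<^sub>R (v - u)))) (at s within {0..1})"
      using has_derivative_compose[OF 1 bump_has_derivative[of e z]] by (simp add: bump_slope_def)
    then show ?thesis
      by (simp add: has_vector_derivative_def bump_slope_def inner_diff_left inner_commute algebra_simps)
  qed
  moreover have "continuous_on {0..1} (\<lambda>s. - bump_slope e (u + s *\<^sub>R (v - u)) z (v - u))"
    unfolding bump_slope_def by (intro continuous_intros)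
  ultimately have "(LINT s|lborel. indicator {0..1} s *\<^sub>R - bump_slope e (u + s *\<^sub>R (v - u)) z (v - u))
    = bump e (u + 1 *\<^sub>R (v - u) - z) - bump e (u + 0 *\<^sub>R (v - u) - z)"
    by (intro integral_FTC_atLeastAtMost) auto
  then show ?thesis by simp
qed

text \<open>The weak gradient tested with bumps centred in S only, for arbitrary directions.
  Integrals run over the whole space, so that f and G can be extensions by zero.\<close>

definition bump_weak_gradient :: "real \<Rightarrow> ('a::euclidean_space \<Rightarrow> real) \<Rightarrow> ('a \<Rightarrow> 'a) \<Rightarrow> 'a set \<Rightarrow> bool"
  where "bump_weak_gradient e f G S \<longleftrightarrow> (\<forall>x\<in>S. \<forall>b.
    (LINT z|lborel. f z * bump_slope e x z b) = - (LINT z|lborel. (G z \<bullet> b) * bump e (x - z)))"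

text \<open>All differentiation falls on the kernel. The double integral over parameter and space is
  dominated by 4 e |v - u| |f|, so Fubini applies; convexity keeps the segment in S, and there the
  weak identity turns the slope into the gradient before absolute values are taken.\<close>

lemma mollify_difference_le:
  fixes f :: "'a::euclidean_space \<Rightarrow> real"
  assumes f: "integrable lborel f" and [measurable]: "G \<in> borel_measurable borel"
    and wg: "bump_weak_gradient e f G S" and S: "convex S" "u \<in> S" "v \<in> S" and e: "0 < e"
  shows "ennreal \<bar>mollify e f u - mollify e f v\<bar> \<le> ennreal (norm (u - v)) *
    (\<integral>\<^sup>+ s. indicator {0..1} s * (\<integral>\<^sup>+ z. ennreal (norm (G z)) * ennreal (bump e (u + s *\<^sub>R (v - u) - z)) \<partial>lborel) \<partial>lborel)"
proof -
  have [measurable]: "f \<in> borel_measurable borel" using f by auto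
  let ?\<gamma> = "\<lambda>s. u + s *\<^sub>R (v - u)"
  let ?F = "\<lambda>s z. indicator {0..1} s * (f z * - bump_slope e (?\<gamma> s) z (v - u))"
  have int: "integrable lborel (\<lambda>z. f z * bump e (x - z))" for x
    by (intro Bochner_Integration.integrable_bound[OF f])
       (auto simp: abs_mult bump_nonneg bump_le_1 intro!: mult_left_le)
  have "integrable (lborel \<Otimes>\<^sub>M lborel) (\<lambda>(s, z). ?F s z)"
  proof (rule Bochner_Integration.integrable_bound)
    show "integrable (lborel \<Otimes>\<^sub>M lborel) (\<lambda>(s, z). indicator {0..1::real} s * (4 * e * norm (v - u)) * f z)"
    proof (rule lborel_pair.Fubini_integrable)
      show "integrable lborel (\<lambda>s. LINT z|lborel. norm (case (s, z) of (s, z) \<Rightarrow> indicator {0..1::real} s * (4 * e * norm (v - u)) * f z))"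
        using e by (simp add: abs_mult)
    qed (use f in auto)
    show "AE w in lborel \<Otimes>\<^sub>M lborel. norm ((\<lambda>(s, z). ?F s z) w) \<le>
       norm ((\<lambda>(s, z). indicator {0..1} s * (4 * e * norm (v - u)) * f z) w)"
    proof (intro AE_I2, clarify)
      fix s :: real and z
      have "\<bar>bump_slope e (?\<gamma> s) z (v - u)\<bar> * \<bar>f z\<bar> \<le> (4 * e * norm (v - u)) * \<bar>f z\<bar>"
        by (intro mult_right_mono bump_slope_bound e) simp
      then show "norm (?F s z) \<le> norm (indicator {0..1} s * (4 * e * norm (v - u)) * f z)"
        using e by (simp add: abs_mult indicator_def mult.commute)
    qed
  qed measurable
  note Fub = lborel_pair.Fubini_integral[OF this]
  have "mollify e f v - mollify e f u = (LINT z|lborel. f z * (bump e (v - z) - bump e (u - z)))"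
    unfolding mollify_def using int by (simp add: right_diff_distrib)
  also have "\<dots> = (LINT z|lborel. (LINT s|lborel. ?F s z))"
    unfolding bump_segment by (simp add: mult.left_commute)
  also have "\<dots> = (LINT s|lborel. (LINT z|lborel. ?F s z))"
    by (rule Fub)
  also have "\<dots> = (LINT s|lborel. indicator {0..1} s * (LINT z|lborel. (G z \<bullet> (v - u)) * bump e (?\<gamma> s - z)))"
  proof (rule Bochner_Integration.integral_cong[OF refl])
    fix s :: real
    have "?\<gamma> s \<in> S" if "s \<in> {0..1}"
      using convexD_alt[OF S, of s] that by (simp add: algebra_simps)
    then show "(LINT z|lborel. ?F s z) = indicator {0..1} s * (LINT z|lborel. (G z \<bullet> (v - u)) * bump e (?\<gamma> s - z))"
      using wg by (auto simp: bump_weak_gradient_def indicator_def)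
  qed
  finally have eq: "mollify e f v - mollify e f u = \<dots>" .
  have "ennreal \<bar>mollify e f v - mollify e f u\<bar> \<le>
    (\<integral>\<^sup>+ s. ennreal (norm (indicator {0..1} s * (LINT z|lborel. (G z \<bullet> (v - u)) * bump e (?\<gamma> s - z)))) \<partial>lborel)"
    unfolding eq real_norm_def[symmetric] by (rule ennreal_norm_integral_le)
  also have "\<dots> \<le> (\<integral>\<^sup>+ s. ennreal (norm (u - v)) * (indicator {0..1} s *
      (\<integral>\<^sup>+ z. ennreal (norm (G z)) * ennreal (bump e (?\<gamma> s - z)) \<partial>lborel)) \<partial>lborel)"
  proof (rule nn_integral_mono)
    fix s :: real
    have "ennreal (norm (LINT z|lborel. (G z \<bullet> (v - u)) * bump e (?\<gamma> s - z)))
      \<le> (\<integral>\<^sup>+ z. ennreal (norm ((G z \<bullet> (v - u)) * bump e (?\<gamma> s - z))) \<partial>lborel)"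
      by (rule ennreal_norm_integral_le)
    also have "\<dots> \<le> (\<integral>\<^sup>+ z. ennreal (norm (u - v)) * (ennreal (norm (G z)) * ennreal (bump e (?\<gamma> s - z))) \<partial>lborel)"
    proof (rule nn_integral_mono)
      fix z
      have "norm ((G z \<bullet> (v - u)) * bump e (?\<gamma> s - z)) \<le> (norm (u - v) * norm (G z)) * bump e (?\<gamma> s - z)"
        using Cauchy_Schwarz_ineq2[of "G z" "v - u"]
        by (simp add: abs_mult bump_nonneg norm_minus_commute mult.commute[of "norm (u - v)"] mult_right_mono)
      then have "ennreal (norm ((G z \<bullet> (v - u)) * bump e (?\<gamma> s - z)))
        \<le> ennreal ((norm (u - v) * norm (G z)) * bump e (?\<gamma> s - z))"
        by (rule ennreal_leI)
      then show "ennreal (norm ((G z \<bullet> (v - u)) * bump e (?\<gamma> s - z)))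
        \<le> ennreal (norm (u - v)) * (ennreal (norm (G z)) * ennreal (bump e (?\<gamma> s - z)))"
        by (simp only: ennreal_mult bump_nonneg norm_ge_zero mult_nonneg_nonneg mult.assoc)
    qed
    also have "\<dots> = ennreal (norm (u - v)) * (\<integral>\<^sup>+ z. ennreal (norm (G z)) * ennreal (bump e (?\<gamma> s - z)) \<partial>lborel)"
      by (intro nn_integral_cmult) measurable
    finally show "ennreal (norm (indicator {0..1} s * (LINT z|lborel. (G z \<bullet> (v - u)) * bump e (?\<gamma> s - z))))
      \<le> ennreal (norm (u - v)) * (indicator {0..1} s *
      (\<integral>\<^sup>+ z. ennreal (norm (G z)) * ennreal (bump e (?\<gamma> s - z)) \<partial>lborel))"
      by (simp add: indicator_def)
  qed
  also have "\<dots> = ennreal (norm (u - v)) *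
    (\<integral>\<^sup>+ s. indicator {0..1} s * (\<integral>\<^sup>+ z. ennreal (norm (G z)) * ennreal (bump e (?\<gamma> s - z)) \<partial>lborel) \<partial>lborel)"
    by (intro nn_integral_cmult) measurable
  finally show ?thesis by (simp add: abs_minus_commute)
qed

text \<open>The affine map sends E to a set E' of measure c^n |E|, which does not exceed |E|, so the
  bound m applies to E'. Undoing the substitution costs c^(-n), at most 2^n since c is at least
  1/2.\<close>

lemma nn_integral_affine_set_le:
  fixes g :: "'a::euclidean_space \<Rightarrow> ennreal"
  assumes [measurable]: "g \<in> borel_measurable borel" "E \<in> sets borel"
    and m: "\<And>E'. E' \<in> sets borel \<Longrightarrow> emeasure lborel E' \<le> emeasure lborel E \<Longrightarrow>
      (\<integral>\<^sup>+ x. g x * indicator E' x \<partial>lborel) \<le> m"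
    and c: "1 / 2 \<le> c" "c \<le> 1"
  shows "(\<integral>\<^sup>+ x. indicator E x * g (t + c *\<^sub>R x) \<partial>lborel) \<le> ennreal (2 ^ DIM('a)) * m"
proof -
  define E' where "E' = (\<lambda>y. (1 / c) *\<^sub>R (y - t)) -` E"
  have ind: "indicator E' (t + c *\<^sub>R x) = (indicator E x :: ennreal)" for x
    using c by (simp add: E'_def indicator_def)
  have [measurable]: "E' \<in> sets borel"
    unfolding E'_def by (rule measurable_sets_borel[OF _ assms(2)]) measurable
  have "emeasure lborel E = (\<integral>\<^sup>+ x. indicator E' (t + c *\<^sub>R x) \<partial>lborel)"
    by (simp add: ind)
  also have "\<dots> = ennreal (1 / c ^ DIM('a)) * emeasure lborel E'"
    using c by (subst nn_integral_affine) auto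
  finally have *: "emeasure lborel E = ennreal (1 / c ^ DIM('a)) * emeasure lborel E'" .
  have "ennreal 1 \<le> ennreal (1 / c ^ DIM('a))"
    using c by (intro ennreal_leI) (simp add: power_le_one)
  then have "emeasure lborel E' \<le> emeasure lborel E"
    unfolding * using mult_right_mono[of "ennreal 1" _ "emeasure lborel E'"] by simp
  then have le: "(\<integral>\<^sup>+ x. g x * indicator E' x \<partial>lborel) \<le> m"
    by (intro m) auto
  have "(\<integral>\<^sup>+ x. indicator E x * g (t + c *\<^sub>R x) \<partial>lborel) =
    (\<integral>\<^sup>+ x. g (t + c *\<^sub>R x) * indicator E' (t + c *\<^sub>R x) \<partial>lborel)"
    by (simp add: ind mult.commute)
  also have "\<dots> = ennreal (1 / c ^ DIM('a)) * (\<integral>\<^sup>+ x. g x * indicator E' x \<partial>lborel)"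
    using c by (subst nn_integral_affine[of "\<lambda>x. g x * indicator E' x"]) auto
  also have "\<dots> \<le> ennreal (2 ^ DIM('a)) * m"
  proof (intro mult_mono le ennreal_leI)
    have "(1 / 2) ^ DIM('a) \<le> c ^ DIM('a)" using c by (intro power_mono) auto
    then show "1 / c ^ DIM('a) \<le> 2 ^ DIM('a)"
      using c by (simp add: field_simps power_one_over)
  qed auto
  finally show ?thesis .
qed

text \<open>Reflecting z writes the convolution as a superposition over h of translates of g with
  weight \<open>bump e h\<close>. For fixed s and h the integral in x is that of g along an affine
  map, bounded independently of h and of the offset w s; what remains is the mass N and the measure
  of S.\<close>

lemma nn_integral_segment_average_le:
  fixes g :: "'a::euclidean_space \<Rightarrow> ennreal" and w :: "real \<Rightarrow> 'a"
  assumes [measurable]: "g \<in> borel_measurable borel" "E \<in> sets borel" "S \<in> sets borel"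
      "c \<in> borel_measurable borel" "w \<in> borel_measurable borel"
    and m: "\<And>E'. E' \<in> sets borel \<Longrightarrow> emeasure lborel E' \<le> emeasure lborel E \<Longrightarrow>
      (\<integral>\<^sup>+ x. g x * indicator E' x \<partial>lborel) \<le> m"
    and c: "\<And>s. s \<in> S \<Longrightarrow> 1 / 2 \<le> c s" "\<And>s. s \<in> S \<Longrightarrow> c s \<le> 1"
    and N: "(\<integral>\<^sup>+ z. ennreal (bump e (z::'a)) \<partial>lborel) = ennreal N"
  shows "(\<integral>\<^sup>+ x. indicator E x * (\<integral>\<^sup>+ s. indicator S s *
      (\<integral>\<^sup>+ z. g z * ennreal (bump e (c s *\<^sub>R x + w s - z)) \<partial>lborel) \<partial>lborel) \<partial>lborel)
    \<le> emeasure lborel S * (ennreal N * (ennreal (2 ^ DIM('a)) * m))"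
proof -
  have inner: "(\<integral>\<^sup>+ x. indicator E x * (\<integral>\<^sup>+ z. g z * ennreal (bump e (c s *\<^sub>R x + w s - z)) \<partial>lborel) \<partial>lborel)
    \<le> ennreal N * (ennreal (2 ^ DIM('a)) * m)" if s: "s \<in> S" for s
  proof -
    have "(\<integral>\<^sup>+ z. g z * ennreal (bump e (c s *\<^sub>R x + w s - z)) \<partial>lborel) =
      (\<integral>\<^sup>+ h. g (c s *\<^sub>R x + w s - h) * ennreal (bump e h) \<partial>lborel)" for x
      using nn_integral_reflect[of "\<lambda>z. g z * ennreal (bump e (c s *\<^sub>R x + w s - z))" "c s *\<^sub>R x + w s"]
      by simp
    then have "(\<integral>\<^sup>+ x. indicator E x * (\<integral>\<^sup>+ z. g z * ennreal (bump e (c s *\<^sub>R x + w s - z)) \<partial>lborel) \<partial>lborel)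
      = (\<integral>\<^sup>+ x. (\<integral>\<^sup>+ h. ennreal (bump e h) * (indicator E x * g (w s - h + c s *\<^sub>R x)) \<partial>lborel) \<partial>lborel)"
      by (intro nn_integral_cong) (simp add: nn_integral_cmult[symmetric] algebra_simps)
    also have "\<dots> = (\<integral>\<^sup>+ h. (\<integral>\<^sup>+ x. ennreal (bump e h) * (indicator E x * g (w s - h + c s *\<^sub>R x)) \<partial>lborel) \<partial>lborel)"
      by (rule lborel_pair.Fubini') measurable
    also have "\<dots> = (\<integral>\<^sup>+ h. ennreal (bump e h) * (\<integral>\<^sup>+ x. indicator E x * g (w s - h + c s *\<^sub>R x) \<partial>lborel) \<partial>lborel)"
      by (intro nn_integral_cong nn_integral_cmult) measurable
    also have "\<dots> \<le> (\<integral>\<^sup>+ h. ennreal (bump e (h::'a)) * (ennreal (2 ^ DIM('a)) * m) \<partial>lborel)"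
      using c s m by (intro nn_integral_mono mult_left_mono nn_integral_affine_set_le) auto
    also have "\<dots> = ennreal N * (ennreal (2 ^ DIM('a)) * m)"
      unfolding N[symmetric] by (rule nn_integral_multc) measurable
    finally show ?thesis .
  qed
  have "(\<integral>\<^sup>+ x. indicator E x * (\<integral>\<^sup>+ s. indicator S s *
      (\<integral>\<^sup>+ z. g z * ennreal (bump e (c s *\<^sub>R x + w s - z)) \<partial>lborel) \<partial>lborel) \<partial>lborel)
    = (\<integral>\<^sup>+ x. (\<integral>\<^sup>+ s. indicator S s * (indicator E x *
      (\<integral>\<^sup>+ z. g z * ennreal (bump e (c s *\<^sub>R x + w s - z)) \<partial>lborel)) \<partial>lborel) \<partial>lborel)"
    by (intro nn_integral_cong, subst nn_integral_cmult[symmetric]) (measurable, simp add: mult.left_commute)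
  also have "\<dots> = (\<integral>\<^sup>+ s. (\<integral>\<^sup>+ x. indicator S s * (indicator E x *
      (\<integral>\<^sup>+ z. g z * ennreal (bump e (c s *\<^sub>R x + w s - z)) \<partial>lborel)) \<partial>lborel) \<partial>lborel)"
    by (rule lborel_pair.Fubini') measurable
  also have "\<dots> = (\<integral>\<^sup>+ s. indicator S s * (\<integral>\<^sup>+ x. indicator E x *
      (\<integral>\<^sup>+ z. g z * ennreal (bump e (c s *\<^sub>R x + w s - z)) \<partial>lborel) \<partial>lborel) \<partial>lborel)"
    by (intro nn_integral_cong nn_integral_cmult) measurable
  also have "\<dots> \<le> (\<integral>\<^sup>+ s. indicator S s * (ennreal N * (ennreal (2 ^ DIM('a)) * m)) \<partial>lborel)"
    using inner by (intro nn_integral_mono) (auto simp: indicator_def)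
  also have "\<dots> = emeasure lborel S * (ennreal N * (ennreal (2 ^ DIM('a)) * m))"
    by (subst nn_integral_multc) auto
  finally show ?thesis .
qed

text \<open>The segment from \<open>x\<close> to \<open>y\<close> is cut at its midpoint: on either half one of the two
  endpoints carries a coefficient of at least \<open>1 / 2\<close>, and is the one to be integrated first.\<close>

lemma mollify_double_integral_le:
  fixes f :: "'a::euclidean_space \<Rightarrow> real"
  assumes f: "integrable lborel f" and [measurable]: "G \<in> borel_measurable borel"
    and wg: "bump_weak_gradient e f G B" and B: "convex B" "B \<in> sets borel" "B \<subseteq> ball a \<rho>"
    and E: "E \<in> sets borel" "E \<subseteq> B" and e: "0 < e"
    and N: "(\<integral>\<^sup>+ z. ennreal (bump e (z::'a)) \<partial>lborel) = ennreal N"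
    and mE: "\<And>E'. E' \<in> sets borel \<Longrightarrow> emeasure lborel E' \<le> emeasure lborel E \<Longrightarrow>
      (\<integral>\<^sup>+ x. ennreal (norm (G x)) * indicator E' x \<partial>lborel) \<le> mE"
    and mB: "\<And>E'. E' \<in> sets borel \<Longrightarrow> emeasure lborel E' \<le> emeasure lborel B \<Longrightarrow>
      (\<integral>\<^sup>+ x. ennreal (norm (G x)) * indicator E' x \<partial>lborel) \<le> mB"
  shows "(\<integral>\<^sup>+ x. indicator E x * (\<integral>\<^sup>+ y. indicator B y * ennreal \<bar>mollify e f x - mollify e f y\<bar> \<partial>lborel) \<partial>lborel)
    \<le> ennreal (\<rho> * N * 2 ^ DIM('a)) * (emeasure lborel B * mE + emeasure lborel E * mB)"
proof (cases "B = {}")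
  case False
  then have \<rho>: "0 < \<rho>" using B(3) by (metis ball_empty not_le subset_empty)
  have [measurable]: "B \<in> sets borel" "E \<in> sets borel" by fact+
  have [measurable]: "f \<in> borel_measurable borel" using f by auto
  define J where "J S x y = (\<integral>\<^sup>+ s. indicator S s *
    (\<integral>\<^sup>+ z. ennreal (norm (G z)) * ennreal (bump e (x + s *\<^sub>R (y - x) - z)) \<partial>lborel) \<partial>lborel)" for S x y
  have [measurable]: "(\<lambda>(x, y). J S x y) \<in> borel_measurable (borel \<Otimes>\<^sub>M borel)"
    "J S x \<in> borel_measurable borel" "(\<lambda>x. J S x y) \<in> borel_measurable borel"
    if [measurable]: "S \<in> sets borel" for S x y
    unfolding J_def by measurable
  \<comment> \<open>Length 1/2 of a half interval, mass N of the kernel, Jacobian cost 2^n.\<close>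
  define K where "K = ennreal (1 / 2) * (ennreal N * ennreal (2 ^ DIM('a)))"
  let ?D = "\<lambda>x y. ennreal \<bar>mollify e f x - mollify e f y\<bar>"
  have D: "?D x y \<le> ennreal (2 * \<rho>) * (J {0..1/2} x y + J {1/2..1} x y)" if "x \<in> B" "y \<in> B" for x y
  proof -
    have "norm (x - y) \<le> 2 * \<rho>"
    proof -
      have "dist a x < \<rho>" "dist a y < \<rho>" using that B(3) by auto
      then show ?thesis using dist_triangle3[of x y a] by (simp add: dist_norm)
    qed
    have "?D x y \<le> ennreal (norm (x - y)) * J {0..1} x y"
      unfolding J_def by (rule mollify_difference_le[OF f _ wg B(1) that e]) measurable
    also have "\<dots> \<le> ennreal (2 * \<rho>) * J {0..1} x y"
      by (intro mult_right_mono ennreal_leI) (fact, simp)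
    also have "J {0..1} x y \<le> J {0..1/2} x y + J {1/2..1} x y"
      unfolding J_def
      by (subst nn_integral_add[symmetric]) (auto intro!: nn_integral_mono simp: indicator_def)
    finally show ?thesis by (simp add: mult_left_mono)
  qed
  \<comment> \<open>Here s is at most 1/2: y is frozen, and x carries the coefficient 1 - s.\<close>
  have J1: "(\<integral>\<^sup>+ x. indicator E x * (\<integral>\<^sup>+ y. indicator B y * J {0..1/2} x y \<partial>lborel) \<partial>lborel) \<le> emeasure lborel B * (K * mE)"
  proof -
    have "(\<integral>\<^sup>+ x. indicator E x * J {0..1/2} x y \<partial>lborel) \<le> K * mE" for y
    proof -
      have "(\<integral>\<^sup>+ x. indicator E x * (\<integral>\<^sup>+ s. indicator {0..1/2} s *
        (\<integral>\<^sup>+ z. ennreal (norm (G z)) * ennreal (bump e ((1 - s) *\<^sub>R x + s *\<^sub>R y - z)) \<partial>lborel) \<partial>lborel) \<partial>lborel)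
        \<le> emeasure lborel {0..1/2::real} * (ennreal N * (ennreal (2 ^ DIM('a)) * mE))"
        by (intro nn_integral_segment_average_le mE N) auto
      then show ?thesis by (simp add: J_def K_def algebra_simps mult.assoc del: ennreal_power ennreal_half)
    qed
    moreover have "(\<integral>\<^sup>+ x. indicator E x * (\<integral>\<^sup>+ y. indicator B y * J {0..1/2} x y \<partial>lborel) \<partial>lborel)
      = (\<integral>\<^sup>+ x. (\<integral>\<^sup>+ y. indicator B y * (indicator E x * J {0..1/2} x y) \<partial>lborel) \<partial>lborel)"
      by (intro nn_integral_cong, subst nn_integral_cmult[symmetric]) (measurable, simp add: mult.left_commute)
    moreover have "\<dots> = (\<integral>\<^sup>+ y. (\<integral>\<^sup>+ x. indicator B y * (indicator E x * J {0..1/2} x y) \<partial>lborel) \<partial>lborel)"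
      by (rule lborel_pair.Fubini') measurable
    moreover have "\<dots> = (\<integral>\<^sup>+ y. indicator B y * (\<integral>\<^sup>+ x. indicator E x * J {0..1/2} x y \<partial>lborel) \<partial>lborel)"
      by (intro nn_integral_cong nn_integral_cmult) measurable
    ultimately have "(\<integral>\<^sup>+ x. indicator E x * (\<integral>\<^sup>+ y. indicator B y * J {0..1/2} x y \<partial>lborel) \<partial>lborel)
      \<le> (\<integral>\<^sup>+ y. indicator B y * (K * mE) \<partial>lborel)"
      by (auto intro!: nn_integral_mono mult_left_mono)
    then show ?thesis by (simp add: nn_integral_multc)
  qed
  \<comment> \<open>Here s is at least 1/2: x is frozen, and y carries the coefficient s and ranges
    over B, whence the bound mB.\<close>
  have J2: "(\<integral>\<^sup>+ x. indicator E x * (\<integral>\<^sup>+ y. indicator B y * J {1/2..1} x y \<partial>lborel) \<partial>lborel) \<le> emeasure lborel E * (K * mB)"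
  proof -
    have "(\<integral>\<^sup>+ y. indicator B y * J {1/2..1} x y \<partial>lborel) \<le> K * mB" for x
    proof -
      have "(\<integral>\<^sup>+ y. indicator B y * (\<integral>\<^sup>+ s. indicator {1/2..1} s *
        (\<integral>\<^sup>+ z. ennreal (norm (G z)) * ennreal (bump e (s *\<^sub>R y + (1 - s) *\<^sub>R x - z)) \<partial>lborel) \<partial>lborel) \<partial>lborel)
        \<le> emeasure lborel {1/2..1::real} * (ennreal N * (ennreal (2 ^ DIM('a)) * mB))"
        by (intro nn_integral_segment_average_le mB N) auto
      then show ?thesis by (simp add: J_def K_def algebra_simps mult.assoc del: ennreal_power ennreal_half)
    qed
    then have "(\<integral>\<^sup>+ x. indicator E x * (\<integral>\<^sup>+ y. indicator B y * J {1/2..1} x y \<partial>lborel) \<partial>lborel)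
      \<le> (\<integral>\<^sup>+ x. indicator E x * (K * mB) \<partial>lborel)"
      by (auto intro!: nn_integral_mono mult_left_mono)
    then show ?thesis by (simp add: nn_integral_multc)
  qed
  have "(\<integral>\<^sup>+ x. indicator E x * (\<integral>\<^sup>+ y. indicator B y * ?D x y \<partial>lborel) \<partial>lborel) \<le>
    (\<integral>\<^sup>+ x. indicator E x * (\<integral>\<^sup>+ y. ennreal (2 * \<rho>) * (indicator B y * J {0..1/2} x y + indicator B y * J {1/2..1} x y) \<partial>lborel) \<partial>lborel)"
  proof (intro nn_integral_mono)
    fix x
    have "(\<integral>\<^sup>+ y. indicator B y * ?D x y \<partial>lborel)
      \<le> (\<integral>\<^sup>+ y. ennreal (2 * \<rho>) * (indicator B y * J {0..1/2} x y + indicator B y * J {1/2..1} x y) \<partial>lborel)"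
      if "x \<in> B"
      using D[OF that] by (intro nn_integral_mono) (simp add: indicator_def)
    then show "indicator E x * (\<integral>\<^sup>+ y. indicator B y * ?D x y \<partial>lborel) \<le>
      indicator E x * (\<integral>\<^sup>+ y. ennreal (2 * \<rho>) * (indicator B y * J {0..1/2} x y + indicator B y * J {1/2..1} x y) \<partial>lborel)"
      using E(2) by (auto simp: indicator_def)
  qed
  also have "\<dots> = ennreal (2 * \<rho>) * ((\<integral>\<^sup>+ x. indicator E x * (\<integral>\<^sup>+ y. indicator B y * J {0..1/2} x y \<partial>lborel) \<partial>lborel)
    + (\<integral>\<^sup>+ x. indicator E x * (\<integral>\<^sup>+ y. indicator B y * J {1/2..1} x y \<partial>lborel) \<partial>lborel))"
    by (simp add: nn_integral_cmult nn_integral_add mult.left_commute[of "indicator E _"] distrib_left)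
  also have "\<dots> \<le> ennreal (2 * \<rho>) * (emeasure lborel B * (K * mE) + emeasure lborel E * (K * mB))"
    by (intro mult_left_mono add_mono J1 J2) simp
  also have "\<dots> = (ennreal (2 * \<rho>) * K) * (emeasure lborel B * mE + emeasure lborel E * mB)"
    by (simp add: distrib_left mult_ac)
  also have "ennreal (2 * \<rho>) * K = ennreal (\<rho> * N * 2 ^ DIM('a))"
  \<comment> \<open>For negative N both sides vanish, since \<open>ennreal\<close> truncates at
    0.\<close>
  proof (cases "0 \<le> N")
    case True
    then show ?thesis using \<rho> by (simp add: K_def ennreal_mult[symmetric] del: ennreal_power ennreal_half)
  next
    case False
    then show ?thesis using \<rho> by (simp add: K_def ennreal_neg mult_nonneg_nonpos mult_nonpos_nonneg)
  qed
  finally show ?thesis .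
qed (use E in auto)

section \<open>Oscillation over a ball\<close>

text \<open>Because N is the mass of the kernel, the error at x is the integral of f(x - h) - f(x)
  against \<open>bump e h\<close>. Only shifts with |h| < e contribute, and each has L^1 size at
  most \<delta>.\<close>

lemma mollify_L1_error:
  fixes f :: "'a::euclidean_space \<Rightarrow> real"
  assumes f: "integrable lborel f" and e: "0 < e"
    and \<delta>: "\<And>h. norm h < e \<Longrightarrow> (\<integral>\<^sup>+ x. ennreal \<bar>f (x - h) - f x\<bar> \<partial>lborel) \<le> ennreal \<delta>"
    and N: "0 \<le> N" "(\<integral>\<^sup>+ z. ennreal (bump e (z::'a)) \<partial>lborel) = ennreal N"
  shows "(\<integral>\<^sup>+ x. ennreal \<bar>mollify e f x - N * f x\<bar> \<partial>lborel) \<le> ennreal N * ennreal \<delta>"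
proof -
  have [measurable]: "f \<in> borel_measurable borel" using f by auto
  have pt: "ennreal \<bar>mollify e f x - N * f x\<bar> \<le> (\<integral>\<^sup>+ h. ennreal (bump e h) * ennreal \<bar>f (x - h) - f x\<bar> \<partial>lborel)" for x
  proof -
    have nn: "(\<integral>\<^sup>+ z. ennreal (bump e (x - z)) \<partial>lborel) = ennreal N"
      using N nn_integral_reflect[of "\<lambda>z. ennreal (bump e z)" x] by simp
    then have int: "integrable lborel (\<lambda>z. bump e (x - z))"
      by (intro integrableI_bounded) (auto simp: bump_nonneg)
    have "(LINT z|lborel. bump e (x - z)) = N"
      using nn N by (subst integral_eq_nn_integral) (auto simp: bump_nonneg)
    moreover have "integrable lborel (\<lambda>z. f z * bump e (x - z))"
      by (intro Bochner_Integration.integrable_bound[OF f])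
         (auto simp: abs_mult bump_nonneg bump_le_1 intro!: mult_left_le)
    ultimately have eq: "mollify e f x - N * f x = (LINT z|lborel. (f z - f x) * bump e (x - z))"
      using int by (simp add: mollify_def left_diff_distrib)
    have "ennreal \<bar>mollify e f x - N * f x\<bar> \<le> (\<integral>\<^sup>+ z. ennreal (norm ((f z - f x) * bump e (x - z))) \<partial>lborel)"
      unfolding eq real_norm_def[symmetric] by (rule ennreal_norm_integral_le)
    also have "\<dots> = (\<integral>\<^sup>+ h. ennreal (norm ((f (x - h) - f x) * bump e (x - (x - h)))) \<partial>lborel)"
      by (rule nn_integral_reflect[symmetric, of "\<lambda>z. ennreal (norm ((f z - f x) * bump e (x - z)))"]) measurable
    also have "\<dots> = (\<integral>\<^sup>+ h. ennreal (bump e h) * ennreal \<bar>f (x - h) - f x\<bar> \<partial>lborel)"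
      by (simp add: abs_mult bump_nonneg ennreal_mult mult.commute)
    finally show ?thesis .
  qed
  have "(\<integral>\<^sup>+ x. ennreal \<bar>mollify e f x - N * f x\<bar> \<partial>lborel) \<le>
    (\<integral>\<^sup>+ x. (\<integral>\<^sup>+ h. ennreal (bump e h) * ennreal \<bar>f (x - h) - f x\<bar> \<partial>lborel) \<partial>lborel)"
    by (intro nn_integral_mono pt)
  also have "\<dots> = (\<integral>\<^sup>+ h. (\<integral>\<^sup>+ x. ennreal (bump e h) * ennreal \<bar>f (x - h) - f x\<bar> \<partial>lborel) \<partial>lborel)"
    by (rule lborel_pair.Fubini') measurable
  also have "\<dots> \<le> (\<integral>\<^sup>+ h. ennreal (bump e (h::'a)) * ennreal \<delta> \<partial>lborel)"
  proof (intro nn_integral_mono)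
    fix h :: 'a
    show "(\<integral>\<^sup>+ x. ennreal (bump e h) * ennreal \<bar>f (x - h) - f x\<bar> \<partial>lborel) \<le> ennreal (bump e h) * ennreal \<delta>"
    proof (cases "norm h < e")
      case True
      then show ?thesis using \<delta>[OF True] by (simp add: nn_integral_cmult mult_left_mono)
    next
      case False
      then have "bump e h = 0" using bump_eq_0_iff[OF e, of h] by simp
      then show ?thesis by simp
    qed
  qed
  also have "\<dots> = ennreal N * ennreal \<delta>"
    unfolding N(2)[symmetric] by (rule nn_integral_multc) measurable
  finally show ?thesis .
qed

text \<open>N |f(x) - f(y)| differs from the mollified difference by the L^1 errors at x and y. The
  main bound contains mE and mB, which do not depend on e, so no convergence of gradients enters; N
  is a common factor of all terms.\<close>

lemma double_integral_le_of_weak_gradient: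
  fixes f :: "'a::euclidean_space \<Rightarrow> real"
  assumes f: "integrable lborel f" and [measurable]: "G \<in> borel_measurable borel"
    and e0: "0 < e0" "\<And>e. 0 < e \<Longrightarrow> e < e0 \<Longrightarrow> bump_weak_gradient e f G B"
    and B: "convex B" "B \<in> sets borel" "B \<subseteq> ball a \<rho>" and \<rho>: "0 < \<rho>"
    and E: "E \<in> sets borel" "E \<subseteq> B"
    and mE: "\<And>E'. E' \<in> sets borel \<Longrightarrow> emeasure lborel E' \<le> emeasure lborel E \<Longrightarrow>
      (\<integral>\<^sup>+ x. ennreal (norm (G x)) * indicator E' x \<partial>lborel) \<le> mE"
    and mB: "\<And>E'. E' \<in> sets borel \<Longrightarrow> emeasure lborel E' \<le> emeasure lborel B \<Longrightarrow>
      (\<integral>\<^sup>+ x. ennreal (norm (G x)) * indicator E' x \<partial>lborel) \<le> mB"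
  shows "(\<integral>\<^sup>+ x. indicator E x * (\<integral>\<^sup>+ y. indicator B y * ennreal \<bar>f x - f y\<bar> \<partial>lborel) \<partial>lborel)
    \<le> ennreal (\<rho> * 2 ^ DIM('a)) * (emeasure lborel B * mE + emeasure lborel E * mB)"
    (is "?L \<le> ?R")
proof (rule ennreal_le_epsilon)
  fix \<eta> :: real assume "0 < \<eta>"
  have [measurable]: "B \<in> sets borel" "E \<in> sets borel" by fact+
  have [measurable]: "f \<in> borel_measurable borel" using f by auto
  have "emeasure lborel B \<le> emeasure lborel (ball a \<rho>)" using B by (intro emeasure_mono) auto
  also have "\<dots> < \<infinity>" using emeasure_lborel_ball_finite[of a \<rho>] by simp
  finally obtain b where b: "emeasure lborel B = ennreal b" "0 \<le> b"
    by (cases "emeasure lborel B") auto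
  have Eb: "emeasure lborel E \<le> ennreal b"
    unfolding b(1)[symmetric] using E by (intro emeasure_mono) auto
  \<comment> \<open>The two error terms add up to at most 2 b N \<delta>; the added 1 covers b =
    0.\<close>
  define \<delta> where "\<delta> = \<eta> / (2 * b + 1)"
  have \<delta>: "0 < \<delta>" "2 * b * \<delta> \<le> \<eta>"
    using \<open>0 < \<eta>\<close> b(2) by (auto simp: \<delta>_def field_simps)
  obtain e1 where e1: "0 < e1" "\<And>h. norm h < e1 \<Longrightarrow> (\<integral>\<^sup>+ x. ennreal \<bar>f (x - h) - f x\<bar> \<partial>lborel) \<le> ennreal \<delta>"
    using translation_continuous_L1[OF f \<delta>(1)] by auto
  define e where "e = min e0 e1 / 2"
  have e: "0 < e" "e < e0" "e < e1" using e0 e1 by (auto simp: e_def)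
  obtain N where N: "0 < N" "(\<integral>\<^sup>+ z. ennreal (bump e (z::'a)) \<partial>lborel) = ennreal N"
    using nn_integral_bump[OF e(1)] .
  define \<epsilon> where "\<epsilon> x = ennreal \<bar>mollify e f x - N * f x\<bar>" for x
  have [measurable]: "mollify e f \<in> borel_measurable borel" unfolding mollify_def by measurable
  have [measurable]: "\<epsilon> \<in> borel_measurable borel" unfolding \<epsilon>_def by measurable
  have \<epsilon>: "(\<integral>\<^sup>+ x. \<epsilon> x \<partial>lborel) \<le> ennreal N * ennreal \<delta>"
    unfolding \<epsilon>_def using N e e1 by (intro mollify_L1_error[OF f e(1)]) auto
  have \<epsilon>': "(\<integral>\<^sup>+ x. indicator S x * \<epsilon> x \<partial>lborel) \<le> ennreal N * ennreal \<delta>" for S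
    by (rule order_trans[OF nn_integral_mono \<epsilon>]) (simp add: indicator_def)
  have pt: "ennreal N * ennreal \<bar>f x - f y\<bar> \<le> ennreal \<bar>mollify e f x - mollify e f y\<bar> + (\<epsilon> x + \<epsilon> y)" for x y
  proof -
    have "N * \<bar>f x - f y\<bar> = \<bar>N * f x - N * f y\<bar>" using N by (simp add: abs_mult flip: right_diff_distrib)
    also have "\<dots> \<le> \<bar>mollify e f x - mollify e f y\<bar> + (\<bar>mollify e f x - N * f x\<bar> + \<bar>mollify e f y - N * f y\<bar>)"
      by linarith
    finally show ?thesis
      using N by (simp add: \<epsilon>_def ennreal_mult[symmetric] ennreal_plus[symmetric] ennreal_leI del: ennreal_plus)
  qed
  let ?D = "\<lambda>x y. ennreal \<bar>mollify e f x - mollify e f y\<bar>"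
  have "ennreal N * ?L = (\<integral>\<^sup>+ x. indicator E x * (\<integral>\<^sup>+ y. indicator B y * (ennreal N * ennreal \<bar>f x - f y\<bar>) \<partial>lborel) \<partial>lborel)"
    by (simp add: nn_integral_cmult[symmetric] mult.left_commute)
  also have "\<dots> \<le> (\<integral>\<^sup>+ x. indicator E x * (\<integral>\<^sup>+ y. indicator B y * (?D x y + (\<epsilon> x + \<epsilon> y)) \<partial>lborel) \<partial>lborel)"
    by (intro nn_integral_mono mult_left_mono pt) auto
  also have "\<dots> = (\<integral>\<^sup>+ x. indicator E x * ((\<integral>\<^sup>+ y. indicator B y * ?D x y \<partial>lborel) + (emeasure lborel B * \<epsilon> x + (\<integral>\<^sup>+ y. indicator B y * \<epsilon> y \<partial>lborel))) \<partial>lborel)"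
    by (simp add: distrib_left nn_integral_add nn_integral_multc)
  also have "\<dots> = (\<integral>\<^sup>+ x. indicator E x * (\<integral>\<^sup>+ y. indicator B y * ?D x y \<partial>lborel) \<partial>lborel) +
     (emeasure lborel B * (\<integral>\<^sup>+ x. indicator E x * \<epsilon> x \<partial>lborel) + emeasure lborel E * (\<integral>\<^sup>+ y. indicator B y * \<epsilon> y \<partial>lborel))"
    by (simp add: distrib_left nn_integral_add nn_integral_multc nn_integral_cmult mult.left_commute[of "indicator E _" "emeasure lborel B"])
  also have "\<dots> \<le> ennreal (\<rho> * N * 2 ^ DIM('a)) * (emeasure lborel B * mE + emeasure lborel E * mB) +
    (ennreal b * (ennreal N * ennreal \<delta>) + ennreal b * (ennreal N * ennreal \<delta>))"
    unfolding b(1)[symmetric]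
    by (intro add_mono mult_mono \<epsilon>' mollify_double_integral_le[OF f _ e0(2)[OF e(1,2)] B E e(1) N(2) mE mB])
       (use Eb b in auto)
  also have "\<dots> = ennreal N * (?R + ennreal (2 * b * \<delta>))"
  proof -
    have "ennreal (\<rho> * N * 2 ^ DIM('a)) = ennreal N * ennreal (\<rho> * 2 ^ DIM('a))"
      using N \<rho> by (simp add: ennreal_mult[symmetric] mult_ac del: ennreal_power)
    moreover have "ennreal b * (ennreal N * ennreal \<delta>) + ennreal b * (ennreal N * ennreal \<delta>) = ennreal N * ennreal (2 * b * \<delta>)"
      using N \<delta> b by (simp add: ennreal_mult[symmetric] ennreal_plus[symmetric] mult_ac del: ennreal_plus)
    ultimately show ?thesis by (simp add: distrib_left mult.assoc)
  qed
  also have "\<dots> \<le> ennreal N * (?R + ennreal \<eta>)"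
    using \<delta>(2) by (intro mult_left_mono add_left_mono ennreal_leI) auto
  finally show "?L \<le> ?R + ennreal \<eta>"
    using N(1) by (subst (asm) ennreal_mult_le_mult_iff) auto
qed

section \<open>Exhaustion of the ball and passage to the mean value\<close>

lemma running_mean_integral_antimono:
  assumes "antimono h" and [measurable]: "h \<in> borel_measurable borel" and "0 \<le> t" "t \<le> u"
  shows "ennreal t * (\<integral>\<^sup>+ s. h s * indicator {0<..u} s \<partial>lborel)
    \<le> ennreal u * (\<integral>\<^sup>+ s. h s * indicator {0<..t} s \<partial>lborel)"
proof (cases "t = 0")
  case False
  then have "0 < t" "0 < u" using assms by auto
  have "ennreal t * (ennreal u * running_mean h u) \<le> ennreal u * (ennreal t * running_mean h t)"
    unfolding mult.left_commute[of "ennreal t"]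
    by (intro mult_left_mono running_mean_antimono assms \<open>0 < t\<close>) auto
  then show ?thesis by (simp add: running_mean_mult[OF \<open>0 < t\<close>] running_mean_mult[OF \<open>0 < u\<close>])
qed simp

text \<open>On a ball of radius r < \<rho> there is room for all bumps with e < \<rho> - r. The
  bounds obtained there are dominated by one quantity of the full ball, so monotone convergence of
  the double integral finishes.\<close>

lemma ball_double_integral_le:
  fixes f :: "'a::euclidean_space \<Rightarrow> real"
  assumes f: "integrable lborel f" and [measurable]: "G \<in> borel_measurable borel"
    and wg: "\<And>r e. 0 < e \<Longrightarrow> r + e < \<rho> \<Longrightarrow> bump_weak_gradient e f G (ball a r)"
    and \<rho>: "0 < \<rho>"
    and h: "antimono h" "h \<in> borel_measurable borel"
    and le: "\<And>E \<tau>. E \<in> sets borel \<Longrightarrow> 0 \<le> \<tau> \<Longrightarrow> emeasure lborel E \<le> ennreal \<tau> \<Longrightarrow>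
      (\<integral>\<^sup>+ x. ennreal (norm (G x)) * indicator E x \<partial>lborel) \<le> (\<integral>\<^sup>+ s. h s * indicator {0<..\<tau>} s \<partial>lborel)"
    and E: "E \<in> sets borel" "E \<subseteq> ball a \<rho>" "emeasure lborel E = ennreal \<tau>" "0 \<le> \<tau>"
  shows "(\<integral>\<^sup>+ x. indicator E x * (\<integral>\<^sup>+ y. indicator (ball a \<rho>) y * ennreal \<bar>f x - f y\<bar> \<partial>lborel) \<partial>lborel)
    \<le> ennreal (\<rho> * 2 ^ (DIM('a) + 1)) * emeasure lborel (ball a \<rho>) * (\<integral>\<^sup>+ s. h s * indicator {0<..\<tau>} s \<partial>lborel)"
proof -
  have [measurable]: "f \<in> borel_measurable borel" "E \<in> sets borel" "h \<in> borel_measurable borel"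
    using f E h by auto
  have [measurable]: "ball a s \<in> sets borel" for s by simp
  define M where "M \<tau> = (\<integral>\<^sup>+ s. h s * indicator {0<..\<tau>} s \<partial>lborel)" for \<tau>
  define R where "R = ennreal (\<rho> * 2 ^ (DIM('a) + 1)) * emeasure lborel (ball a \<rho>) * M \<tau>"
  \<comment> \<open>Radii increasing to \<rho> and staying below it; the offset 2 makes even the
    first one positive.\<close>
  define r where "r k = \<rho> * (1 - 1 / real (k + 2))" for k
  have r: "r k < \<rho>" for k using \<rho> by (simp add: r_def)
  have r_mono: "r k \<le> r l" if "k \<le> l" for k l
    using \<rho> that by (simp add: r_def frac_le)
  have r_lim: "r \<longlonglongrightarrow> \<rho>"
  proof -
    have "(\<lambda>k. \<rho> * (1 - 1 / real (k + 2))) \<longlonglongrightarrow> \<rho> * (1 - 0)"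
      using LIMSEQ_ignore_initial_segment[OF lim_1_over_n, of 2] by (intro tendsto_intros) simp
    then show ?thesis by (simp add: r_def[abs_def])
  qed
  define P where "P k w = (case w of (x, y) \<Rightarrow>
    indicator (E \<inter> ball a (r k)) x * (indicator (ball a (r k)) y * ennreal \<bar>f x - f y\<bar>))" for k w
  have [measurable]: "P k \<in> borel_measurable (lborel \<Otimes>\<^sub>M lborel)" for k
    unfolding P_def by measurable
  have "(\<lambda>k. integral\<^sup>N (lborel \<Otimes>\<^sub>M lborel) (P k)) \<longlonglongrightarrow>
    (\<integral>\<^sup>+ w. (case w of (x, y) \<Rightarrow> indicator E x * (indicator (ball a \<rho>) y * ennreal \<bar>f x - f y\<bar>)) \<partial>(lborel \<Otimes>\<^sub>M lborel))"
  proof (rule nn_integral_LIMSEQ)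
    show "incseq P"
      using r_mono by (auto simp: incseq_def le_fun_def P_def indicator_def intro: order.strict_trans2)
    fix w :: "'a \<times> 'a"
    obtain x y where w: "w = (x, y)" by fastforce
    show "(\<lambda>k. P k w) \<longlonglongrightarrow> (case w of (x, y) \<Rightarrow> indicator E x * (indicator (ball a \<rho>) y * ennreal \<bar>f x - f y\<bar>))"
    proof (cases "x \<in> E \<and> y \<in> ball a \<rho>")
      case True
      then have "dist a x < \<rho>" "dist a y < \<rho>" using E by auto
      then have "eventually (\<lambda>k. dist a x < r k \<and> dist a y < r k) sequentially"
        using order_tendstoD(1)[OF r_lim] by (simp add: eventually_conj)
      then have "eventually (\<lambda>k. P k w = (case w of (x, y) \<Rightarrow> indicator E x * (indicator (ball a \<rho>) y * ennreal \<bar>f x - f y\<bar>))) sequentially"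
        by eventually_elim (use True in \<open>auto simp: P_def w\<close>)
      then show ?thesis by (rule tendsto_eventually)
    next
      case False
      then have "P k w = 0" for k using r[of k] by (auto simp: P_def w indicator_def)
      then show ?thesis using False by (auto simp: w indicator_def)
    qed
  qed measurable
  moreover have "integral\<^sup>N (lborel \<Otimes>\<^sub>M lborel) (P k) \<le> R" for k
  proof -
    let ?B = "ball a (r k)" and ?E = "E \<inter> ball a (r k)"
    obtain b where b: "emeasure lborel ?B = ennreal b" "0 \<le> b"
      using emeasure_lborel_ball_finite[of a "r k"] by (cases "emeasure lborel ?B") auto
    obtain t where t: "emeasure lborel ?E = ennreal t" "0 \<le> t" "t \<le> \<tau>"
      using emeasure_mono[of ?E E lborel] E by (cases "emeasure lborel ?E") (auto simp: top_unique)
    have tb: "t \<le> b"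
      using emeasure_mono[of ?E ?B lborel] t b by simp
    have "integral\<^sup>N (lborel \<Otimes>\<^sub>M lborel) (P k) =
      (\<integral>\<^sup>+ x. indicator ?E x * (\<integral>\<^sup>+ y. indicator ?B y * ennreal \<bar>f x - f y\<bar> \<partial>lborel) \<partial>lborel)"
      by (subst lborel.nn_integral_fst[symmetric]) (simp_all add: P_def nn_integral_cmult)
    also have "\<dots> \<le> ennreal (\<rho> * 2 ^ DIM('a)) * (emeasure lborel ?B * M t + emeasure lborel ?E * M b)"
      unfolding M_def
    proof (rule double_integral_le_of_weak_gradient[OF f, of _ "\<rho> - r k" _ a])
      show "bump_weak_gradient e f G ?B" if "0 < e" "e < \<rho> - r k" for e
        using that by (intro wg) auto
    qed (use r[of k] \<rho> t b le in auto)
    also have "\<dots> \<le> ennreal (\<rho> * 2 ^ DIM('a)) * (ennreal b * M t + ennreal b * M t)"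
      unfolding t b M_def by (intro mult_left_mono add_mono running_mean_integral_antimono h t tb) auto
    also have "\<dots> = ennreal (\<rho> * 2 ^ (DIM('a) + 1)) * ennreal b * M t"
    proof -
      \<comment> \<open>Two equal terms, one from each half of the segments, turn 2^n into
        2^(n+1).\<close>
      have "ennreal (\<rho> * 2 ^ (DIM('a) + 1)) = ennreal (\<rho> * 2 ^ DIM('a)) + ennreal (\<rho> * 2 ^ DIM('a))"
        using \<rho> by (simp add: ennreal_plus[symmetric] del: ennreal_plus)
      then show ?thesis by (simp only: distrib_left distrib_right mult.assoc)
    qed
    also have "\<dots> \<le> R"
      unfolding R_def M_def b(1)[symmetric]
    proof (intro mult_mono order_refl nn_integral_mono)
      show "emeasure lborel ?B \<le> emeasure lborel (ball a \<rho>)"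
        using r[of k] by (intro emeasure_mono) auto
    qed (use t in \<open>auto simp: indicator_def\<close>)
    finally show ?thesis .
  qed
  ultimately have "(\<integral>\<^sup>+ w. (case w of (x, y) \<Rightarrow> indicator E x * (indicator (ball a \<rho>) y * ennreal \<bar>f x - f y\<bar>)) \<partial>(lborel \<Otimes>\<^sub>M lborel)) \<le> R"
    by (intro LIMSEQ_le_const2) auto
  then show ?thesis
    by (subst (asm) lborel.nn_integral_fst[symmetric]) (simp_all add: R_def M_def nn_integral_cmult)
qed

text \<open>Since f vanishes outside the ball, |B| (f(x) - m) is the integral of f(x) - f(y) over y
  in B. The factor |B| on the left then cancels the one in the double-integral bound.\<close>

lemma ball_mean_oscillation_le:
  fixes f :: "'a::euclidean_space \<Rightarrow> real"
  assumes f: "integrable lborel f" "\<And>x. x \<notin> ball a \<rho> \<Longrightarrow> f x = 0" and \<rho>: "0 < \<rho>"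
    and E: "E \<in> sets borel"
    and m: "m = 1 / measure lborel (ball a \<rho>) * (LINT x|lborel. f x)"
    and le: "(\<integral>\<^sup>+ x. indicator E x * (\<integral>\<^sup>+ y. indicator (ball a \<rho>) y * ennreal \<bar>f x - f y\<bar> \<partial>lborel) \<partial>lborel)
      \<le> K * emeasure lborel (ball a \<rho>) * M"
  shows "(\<integral>\<^sup>+ x. ennreal \<bar>f x - m\<bar> * indicator E x \<partial>lborel) \<le> K * M"
proof -
  have [measurable]: "f \<in> borel_measurable borel" "E \<in> sets borel" using f E by auto
  define b where "b = measure lborel (ball a \<rho>)"
  have b: "0 < b" "emeasure lborel (ball a \<rho>) = ennreal b"
    using content_ball_pos[OF \<rho>, of a] emeasure_lborel_ball_finite[of a \<rho>]
    by (auto simp: b_def emeasure_eq_ennreal_measure)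
  have pt: "ennreal b * ennreal \<bar>f x - m\<bar> \<le> (\<integral>\<^sup>+ y. indicator (ball a \<rho>) y * ennreal \<bar>f x - f y\<bar> \<partial>lborel)" for x
  proof -
    have int: "integrable lborel (\<lambda>y. indicator (ball a \<rho>) y * f x)"
      using emeasure_lborel_ball_finite[of a \<rho>] by (intro integrable_mult_left) auto
    have "b * (f x - m) = (LINT y|lborel. indicator (ball a \<rho>) y * f x) - (LINT y|lborel. f y)"
      using b(1) by (simp add: m b_def right_diff_distrib)
    also have "\<dots> = (LINT y|lborel. indicator (ball a \<rho>) y * f x - f y)"
      using f int by simp
    also have "\<dots> = (LINT y|lborel. indicator (ball a \<rho>) y * (f x - f y))"
      by (intro Bochner_Integration.integral_cong) (auto simp: indicator_def f(2))
    finally have "ennreal \<bar>b * (f x - m)\<bar> \<le> (\<integral>\<^sup>+ y. ennreal (norm (indicator (ball a \<rho>) y * (f x - f y))) \<partial>lborel)"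
      using ennreal_norm_integral_le[of lborel "\<lambda>y. indicator (ball a \<rho>) y * (f x - f y)"] by simp
    also have "\<dots> = (\<integral>\<^sup>+ y. indicator (ball a \<rho>) y * ennreal \<bar>f x - f y\<bar> \<partial>lborel)"
      by (intro nn_integral_cong) (auto simp: indicator_def)
    finally show ?thesis using b(1) by (simp add: abs_mult ennreal_mult)
  qed
  have "ennreal b * (\<integral>\<^sup>+ x. ennreal \<bar>f x - m\<bar> * indicator E x \<partial>lborel)
    = (\<integral>\<^sup>+ x. indicator E x * (ennreal b * ennreal \<bar>f x - m\<bar>) \<partial>lborel)"
    by (subst nn_integral_cmult[symmetric]) (auto simp: mult_ac)
  also have "\<dots> \<le> (\<integral>\<^sup>+ x. indicator E x * (\<integral>\<^sup>+ y. indicator (ball a \<rho>) y * ennreal \<bar>f x - f y\<bar> \<partial>lborel) \<partial>lborel)"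
    by (intro nn_integral_mono mult_left_mono pt) auto
  also have "\<dots> \<le> ennreal b * (K * M)" using le by (simp add: b mult_ac)
  finally show ?thesis using b(1) by (subst (asm) ennreal_mult_le_mult_iff) auto
qed

section \<open>Borel representatives and the weak gradient\<close>

lemma distribution_fun_cong_AE:
  fixes u v :: "'a::euclidean_space \<Rightarrow> 'b::euclidean_space"
  assumes "AE x in lebesgue. x \<in> \<Omega> \<longrightarrow> u x = v x" and "\<Omega> \<in> sets lebesgue"
    and "set_borel_measurable lebesgue \<Omega> u" "set_borel_measurable lebesgue \<Omega> v"
  shows "distribution_fun \<Omega> u = distribution_fun \<Omega> v"
proof
  fix \<alpha> :: real
  have sets: "{x \<in> \<Omega>. norm (w x) > \<alpha>} \<in> sets lebesgue" if "set_borel_measurable lebesgue \<Omega> w" for w :: "'a \<Rightarrow> 'b"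
  proof -
    have "(\<lambda>x. norm (indicator \<Omega> x *\<^sub>R w x)) \<in> borel_measurable lebesgue"
      using measurable_compose[OF that[unfolded set_borel_measurable_def] borel_measurable_norm] .
    then have "(\<lambda>x. norm (indicator \<Omega> x *\<^sub>R w x)) -` {\<alpha><..} \<inter> space lebesgue \<in> sets lebesgue"
      by (rule measurable_sets) simp
    with assms(2) have "\<Omega> \<inter> ((\<lambda>x. norm (indicator \<Omega> x *\<^sub>R w x)) -` {\<alpha><..}) \<in> sets lebesgue" by auto
    moreover have "\<Omega> \<inter> ((\<lambda>x. norm (indicator \<Omega> x *\<^sub>R w x)) -` {\<alpha><..}) = {x \<in> \<Omega>. norm (w x) > \<alpha>}"
      by auto
    ultimately show ?thesis by simp
  qed
  show "distribution_fun \<Omega> u \<alpha> = distribution_fun \<Omega> v \<alpha>"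
    unfolding distribution_fun_def
    using assms(1) by (intro emeasure_eq_AE sets assms) (auto elim!: eventually_mono)
qed

lemma borel_imp_set_borel_measurable_lebesgue:
  fixes w :: "'a::euclidean_space \<Rightarrow> 'b::euclidean_space"
  assumes "w \<in> borel_measurable borel" "\<Omega> \<in> sets borel"
  shows "set_borel_measurable lebesgue \<Omega> w"
proof -
  have "(\<lambda>x. indicator \<Omega> x *\<^sub>R w x) \<in> borel_measurable lborel"
    using assms by (intro borel_measurable_scaleR borel_measurable_indicator) auto
  then show ?thesis unfolding set_borel_measurable_def by (rule measurable_completion)
qed

lemma decr_rearrangement_cong:
  "distribution_fun \<Omega> u = distribution_fun \<Omega> v \<Longrightarrow> decr_rearrangement \<Omega> u = decr_rearrangement \<Omega> v"
  unfolding decr_rearrangement_def[abs_def] by simp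

text \<open>Fubini and the affine substitutions take place over \<open>lborel\<close>, while the
  given functions are only Lebesgue measurable on the domain. The real-valued case is applied to
  each coordinate, and a final cut-off makes the representative vanish off the domain.\<close>

lemma lebesgue_ex_borel_representative:
  fixes g :: "'a::euclidean_space \<Rightarrow> 'b::euclidean_space"
  assumes \<Omega>: "\<Omega> \<in> sets borel" and g: "set_borel_measurable lebesgue \<Omega> g"
  obtains g' where "g' \<in> borel_measurable borel" "AE x in lebesgue. indicator \<Omega> x *\<^sub>R g x = g' x"
    "\<And>x. x \<notin> \<Omega> \<Longrightarrow> g' x = 0"
proof -
  have "\<exists>c. c \<in> borel_measurable borel \<and> (AE x in lborel. (indicator \<Omega> x *\<^sub>R g x) \<bullet> i = c x)" for i
  proof -
    have "(\<lambda>x. (indicator \<Omega> x *\<^sub>R g x) \<bullet> i) \<in> borel_measurable lebesgue"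
      using g unfolding set_borel_measurable_def by (rule borel_measurable_inner) simp
    from completion_ex_borel_measurable_real[OF this] show ?thesis by auto
  qed
  then have "\<forall>i. \<exists>c. c \<in> borel_measurable borel \<and> (AE x in lborel. (indicator \<Omega> x *\<^sub>R g x) \<bullet> i = c x)"
    by blast
  from choice[OF this] obtain c where c: "\<forall>i. c i \<in> borel_measurable borel \<and>
      (AE x in lborel. (indicator \<Omega> x *\<^sub>R g x) \<bullet> i = c i x)"
    by (elim exE)
  then have [measurable]: "c i \<in> borel_measurable borel"
    and ae: "AE x in lborel. (indicator \<Omega> x *\<^sub>R g x) \<bullet> i = c i x" for i
    by simp_all
  have [measurable]: "\<Omega> \<in> sets borel" by fact
  show thesis
  proof
    show "(\<lambda>x. indicator \<Omega> x *\<^sub>R (\<Sum>i\<in>Basis. c i x *\<^sub>R i)) \<in> borel_measurable borel" by measurable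
    have "AE x in lborel. \<forall>i\<in>Basis. (indicator \<Omega> x *\<^sub>R g x) \<bullet> i = c i x"
      by (rule AE_finite_allI[OF finite_Basis]) (rule ae)
    then have "AE x in lborel. indicator \<Omega> x *\<^sub>R g x = indicator \<Omega> x *\<^sub>R (\<Sum>i\<in>Basis. c i x *\<^sub>R i)"
    proof eventually_elim
      case (elim x)
      have "(\<Sum>i\<in>Basis. c i x *\<^sub>R i) = (\<Sum>i\<in>Basis. ((indicator \<Omega> x *\<^sub>R g x) \<bullet> i) *\<^sub>R i)"
        by (rule sum.cong[OF refl]) (simp only: elim)
      also have "\<dots> = indicator \<Omega> x *\<^sub>R g x"
        by (rule euclidean_representation)
      finally have "(\<Sum>i\<in>Basis. c i x *\<^sub>R i) = indicator \<Omega> x *\<^sub>R g x" .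
      then show ?case by (auto simp: indicator_def)
    qed
    then show "AE x in lebesgue. indicator \<Omega> x *\<^sub>R g x = indicator \<Omega> x *\<^sub>R (\<Sum>i\<in>Basis. c i x *\<^sub>R i)"
      by (rule AE_completion)
  qed auto
qed

text \<open>The condition T 0 x = 0 lets the cut-off be moved from the integrand into the argument
  of T, where the representative is available.\<close>

lemma set_lebesgue_integral_representative:
  fixes g g' :: "'a::euclidean_space \<Rightarrow> 'b::euclidean_space" and T :: "'b \<Rightarrow> 'a \<Rightarrow> real"
  assumes ae: "AE x in lebesgue. indicator \<Omega> x *\<^sub>R g x = g' x"
    and g: "set_borel_measurable lebesgue \<Omega> g" and [measurable]: "g' \<in> borel_measurable borel"
    and [measurable]: "(\<lambda>(y, x). T y x) \<in> borel_measurable (borel \<Otimes>\<^sub>M borel)"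
    and T: "\<And>x. T 0 x = 0"
  shows "(LINT x:\<Omega>|lebesgue. T (g x) x) = (LINT x|lborel. T (g' x) x)"
proof -
  have 1: "(\<lambda>x. indicator \<Omega> x *\<^sub>R g x) \<in> lebesgue \<rightarrow>\<^sub>M borel"
    using g by (simp add: set_borel_measurable_def)
  have 2: "(\<lambda>x. x) \<in> lebesgue \<rightarrow>\<^sub>M (borel :: 'a measure)"
    by (simp add: measurable_completion)
  have meas: "(\<lambda>x. T (indicator \<Omega> x *\<^sub>R g x) x) \<in> borel_measurable lebesgue"
    using measurable_compose[OF measurable_Pair[OF 1 2] assms(4)] by simp
  have "(LINT x:\<Omega>|lebesgue. T (g x) x) = (LINT x|lebesgue. T (indicator \<Omega> x *\<^sub>R g x) x)"
    unfolding set_lebesgue_integral_def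
    by (intro Bochner_Integration.integral_cong) (auto simp: indicator_def T)
  also have "\<dots> = (LINT x|lebesgue. T (g' x) x)"
    using ae by (intro integral_cong_AE meas measurable_completion) (auto elim: eventually_mono)
  also have "\<dots> = (LINT x|lborel. T (g' x) x)"
    by (rule integral_completion) measurable
  finally show ?thesis .
qed

text \<open>The bump centred at x is an admissible test function because its support is the closed
  e-ball around x, contained in the domain. This settles basis directions; a general direction
  follows by linearity once all summands are integrable.\<close>

lemma bump_weak_gradient_representative:
  fixes f f' :: "'a::euclidean_space \<Rightarrow> real"
  assumes wg: "has_weak_gradient_on f G \<Omega>" and \<Omega>: "\<Omega> \<in> sets borel"
    and f: "AE x in lebesgue. indicator \<Omega> x *\<^sub>R f x = f' x" "set_borel_measurable lebesgue \<Omega> f"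
      "integrable lborel f'"
    and G: "AE x in lebesgue. indicator \<Omega> x *\<^sub>R G x = G' x" "set_borel_measurable lebesgue \<Omega> G"
      "G' \<in> borel_measurable borel"
    and e: "0 < e" and S: "\<And>x. x \<in> S \<Longrightarrow> cball x e \<subseteq> \<Omega>"
  shows "bump_weak_gradient e f' G' S"
  unfolding bump_weak_gradient_def
proof safe
  fix x b assume "x \<in> S"
  note K = S[OF \<open>x \<in> S\<close>]
  have [measurable]: "f' \<in> borel_measurable borel" "G' \<in> borel_measurable borel" "\<Omega> \<in> sets borel"
    using f G \<Omega> by auto
  have basis: "(LINT z|lborel. f' z * bump_slope e x z i) = - (LINT z|lborel. (G' z \<bullet> i) * bump e (x - z))"
    if "i \<in> Basis" for i
  proof -
    have "(LINT z:\<Omega>|lebesgue. f z * bump_slope e x z i) = - (LINT z:\<Omega>|lebesgue. (G z \<bullet> i) * bump e (x - z))"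
      using wg bump_test_function[OF e K] that
      unfolding has_weak_gradient_on_def frechet_derivative_bump[symmetric] by blast
    moreover have "(LINT z:\<Omega>|lebesgue. f z * bump_slope e x z i) = (LINT z|lborel. f' z * bump_slope e x z i)"
      by (rule set_lebesgue_integral_representative[OF f(1,2), of "\<lambda>y z. y * bump_slope e x z i"]) auto
    moreover have "(LINT z:\<Omega>|lebesgue. (G z \<bullet> i) * bump e (x - z)) = (LINT z|lborel. (G' z \<bullet> i) * bump e (x - z))"
      by (rule set_lebesgue_integral_representative[OF G(1,2), of "\<lambda>y z. (y \<bullet> i) * bump e (x - z)"]) auto
    ultimately show ?thesis by simp
  qed
  have int_f: "integrable lborel (\<lambda>z. f' z * bump_slope e x z i)" for i
  proof (rule Bochner_Integration.integrable_bound)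
    show "integrable lborel (\<lambda>z. (4 * e * norm i) * f' z)" using f(3) by simp
    show "AE z in lborel. norm (f' z * bump_slope e x z i) \<le> norm ((4 * e * norm i) * f' z)"
    proof (intro AE_I2)
      fix z
      have "\<bar>f' z\<bar> * \<bar>bump_slope e x z i\<bar> \<le> \<bar>f' z\<bar> * (4 * e * norm i)"
        by (intro mult_left_mono bump_slope_bound e) simp
      then show "norm (f' z * bump_slope e x z i) \<le> norm ((4 * e * norm i) * f' z)"
        using e by (simp add: abs_mult mult_ac)
    qed
  qed measurable
  \<comment> \<open>The gradient is only locally integrable; the compact support of the bump
    localises its integral to this ball.\<close>
  have "G absolutely_integrable_on (cball x e)"
    using wg K by (auto simp: has_weak_gradient_on_def locally_integrable_on_def)
  then have "integrable lebesgue (\<lambda>z. indicator (cball x e) z *\<^sub>R G z)"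
    by (simp add: set_integrable_def)
  then have "integrable lebesgue (\<lambda>z. indicator (cball x e) z *\<^sub>R G' z)"
  proof (rule integrable_cong_AE_imp)
    show "AE z in lebesgue. indicator (cball x e) z *\<^sub>R G z = indicator (cball x e) z *\<^sub>R G' z"
      using G(1) by eventually_elim (use K in \<open>auto simp: indicator_def\<close>)
  next
    show "(\<lambda>z. indicator (cball x e) z *\<^sub>R G' z) \<in> borel_measurable lebesgue"
      using borel_imp_set_borel_measurable_lebesgue[OF G(3), of "cball x e"]
      by (simp add: set_borel_measurable_def)
  qed
  then have intG': "integrable lborel (\<lambda>z. indicator (cball x e) z *\<^sub>R G' z)"
  proof (subst (asm) integrable_completion)
    show "(\<lambda>z. indicator (cball x e) z *\<^sub>R G' z) \<in> borel_measurable lborel"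
      using G(3) by (intro borel_measurable_scaleR borel_measurable_indicator) auto
  qed
  have int_G: "integrable lborel (\<lambda>z. (G' z \<bullet> i) * bump e (x - z))" if "i \<in> Basis" for i
  proof (rule Bochner_Integration.integrable_bound[OF intG'])
    have "norm ((G' z \<bullet> i) * bump e (x - z)) \<le> norm (indicator (cball x e) z *\<^sub>R G' z)" for z
    proof (cases "z \<in> cball x e")
      case True
      have "\<bar>G' z \<bullet> i\<bar> * bump e (x - z) \<le> norm (G' z) * 1"
        by (intro mult_mono Basis_le_norm that bump_le_1 bump_nonneg) auto
      then show ?thesis using True by (simp add: abs_mult bump_nonneg)
    next
      case False
      then have "bump e (x - z) = 0" using bump_eq_0_iff[OF e, of "x - z"] by (simp add: dist_norm)
      then show ?thesis by simp
    qed
    then show "AE z in lborel. norm ((G' z \<bullet> i) * bump e (x - z)) \<le> norm (indicator (cball x e) z *\<^sub>R G' z)" by simp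
  qed measurable
  have "(LINT z|lborel. f' z * bump_slope e x z b) = (LINT z|lborel. (\<Sum>i\<in>Basis. (b \<bullet> i) * (f' z * bump_slope e x z i)))"
    by (subst bump_slope_sum) (simp add: sum_distrib_left mult.left_commute)
  also have "\<dots> = (\<Sum>i\<in>Basis. (b \<bullet> i) * (LINT z|lborel. f' z * bump_slope e x z i))"
    using int_f by (simp add: Bochner_Integration.integral_sum)
  also have "\<dots> = - (\<Sum>i\<in>Basis. (b \<bullet> i) * (LINT z|lborel. (G' z \<bullet> i) * bump e (x - z)))"
    by (simp add: basis sum_negf)
  also have "\<dots> = - (LINT z|lborel. (\<Sum>i\<in>Basis. (b \<bullet> i) * ((G' z \<bullet> i) * bump e (x - z))))"
    using int_G by (simp add: Bochner_Integration.integral_sum)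
  also have "\<dots> = - (LINT z|lborel. (G' z \<bullet> b) * bump e (x - z))"
    by (simp add: euclidean_inner[of _ b] sum_distrib_left mult_ac)
  finally show "(LINT z|lborel. f' z * bump_slope e x z b) = - (LINT z|lborel. (G' z \<bullet> b) * bump e (x - z))" .
qed

text \<open>The pointwise estimate of the overview. It is proved for Borel representatives vanishing
  off the ball and carried back, as rearrangements and the mean do not see null sets.\<close>

lemma decr_rearrangement_poincare:
  fixes f :: "'a::euclidean_space \<Rightarrow> real" and G :: "'a \<Rightarrow> 'a"
  assumes \<rho>: "0 < \<rho>" and f: "f absolutely_integrable_on ball a \<rho>"
    and wg: "has_weak_gradient_on f G (ball a \<rho>)" and G: "set_borel_measurable lebesgue (ball a \<rho>) G"
    and t: "0 < t"
  shows "decr_rearrangement (ball a \<rho>) (\<lambda>x. f x - mean_on (ball a \<rho>) f) t \<le>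
    ennreal (\<rho> * 2 ^ (DIM('a) + 1)) * running_mean (decr_rearrangement (ball a \<rho>) G) t"
proof -
  let ?B = "ball a \<rho>"
  define m where "m = mean_on ?B f"
  have fm: "set_borel_measurable lebesgue ?B f"
    using f by (simp add: set_integrable_def set_borel_measurable_def borel_measurable_integrable)
  obtain f' where f': "f' \<in> borel_measurable borel" "AE x in lebesgue. indicator ?B x *\<^sub>R f x = f' x"
    "\<And>x. x \<notin> ?B \<Longrightarrow> f' x = 0"
    using lebesgue_ex_borel_representative[OF _ fm] by auto
  obtain G' where G': "G' \<in> borel_measurable borel" "AE x in lebesgue. indicator ?B x *\<^sub>R G x = G' x"
    "\<And>x. x \<notin> ?B \<Longrightarrow> G' x = 0"
    using lebesgue_ex_borel_representative[OF _ G] by auto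
  note [measurable] = f'(1) G'(1)
  have int: "integrable lborel f'"
  proof -
    have "integrable lebesgue f'"
      using f[unfolded set_integrable_def] _ f'(2)
      by (rule integrable_cong_AE_imp) (simp add: measurable_completion)
    then show ?thesis by (subst (asm) integrable_completion) auto
  qed
  have m: "m = 1 / measure lborel ?B * (LINT x|lborel. f' x)"
    using set_lebesgue_integral_representative[OF f'(2) fm f'(1), of "\<lambda>y x. y"]
    by (simp add: m_def mean_on_def)
  define h where "h = decr_rearrangement ?B G'"
  have h: "antimono h" "h \<in> borel_measurable borel"
    unfolding h_def by (rule antimono_decr_rearrangement, measurable)
  have "decr_rearrangement ?B (\<lambda>x. f' x - m) t \<le> ennreal (\<rho> * 2 ^ (DIM('a) + 1)) * running_mean h t"
  proof (rule decr_rearrangement_le_running_mean[OF h t])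
    fix \<alpha>
    have "distribution_fun ?B (\<lambda>x. f' x - m) \<alpha> \<le> emeasure lborel ?B"
      by (subst distribution_fun_lborel) (auto intro!: emeasure_mono)
    then show "distribution_fun ?B (\<lambda>x. f' x - m) \<alpha> < \<infinity>"
      using emeasure_lborel_ball_finite[of a \<rho>] by (simp add: le_less_trans)
  next
    fix \<alpha> \<tau> :: real assume "0 < \<alpha>" "0 < \<tau>" and \<tau>: "distribution_fun ?B (\<lambda>x. f' x - m) \<alpha> = ennreal \<tau>"
    define E where "E = {x \<in> ?B. norm (f' x - m) > \<alpha>}"
    have E_sub: "E \<subseteq> ?B" by (auto simp: E_def)
    have E_sets [measurable]: "E \<in> sets borel" unfolding E_def by measurable
    have E: "emeasure lborel E = ennreal \<tau>"
      using \<tau> by (subst (asm) distribution_fun_lborel) (auto simp: E_def)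
    \<comment> \<open>Chebyshev's inequality on the superlevel set E.\<close>
    have "ennreal \<alpha> * ennreal \<tau> = (\<integral>\<^sup>+ x. ennreal \<alpha> * indicator E x \<partial>lborel)"
      by (simp add: nn_integral_cmult E)
    also have "\<dots> \<le> (\<integral>\<^sup>+ x. ennreal \<bar>f' x - m\<bar> * indicator E x \<partial>lborel)"
      by (intro nn_integral_mono) (auto simp: E_def indicator_def ennreal_leI)
    also have "\<dots> \<le> ennreal (\<rho> * 2 ^ (DIM('a) + 1)) * (\<integral>\<^sup>+ s. h s * indicator {0<..\<tau>} s \<partial>lborel)"
    proof (rule ball_mean_oscillation_le[OF int f'(3) \<rho> _ m])
      show "(\<integral>\<^sup>+ x. indicator E x * (\<integral>\<^sup>+ y. indicator ?B y * ennreal \<bar>f' x - f' y\<bar> \<partial>lborel) \<partial>lborel)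
        \<le> ennreal (\<rho> * 2 ^ (DIM('a) + 1)) * emeasure lborel ?B * (\<integral>\<^sup>+ s. h s * indicator {0<..\<tau>} s \<partial>lborel)"
      proof (rule ball_double_integral_le[OF int G'(1) _ \<rho> h _ E_sets E_sub E])
        show "bump_weak_gradient e f' G' (ball a r)" if "0 < e" "r + e < \<rho>" for r e
        proof (rule bump_weak_gradient_representative[OF wg _ f'(2) fm int G'(2) G G'(1) \<open>0 < e\<close>])
          show "cball x e \<subseteq> ?B" if "x \<in> ball a r" for x
          proof
            fix y assume "y \<in> cball x e"
            then have "dist a x < r" "dist x y \<le> e" using that by simp_all
            then have "dist a y < \<rho>"
              using dist_triangle[of a y x] \<open>r + e < \<rho>\<close> by linarith
            then show "y \<in> ?B" by simp
          qed
        qed simp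
        fix E' :: "'a set" and \<tau> :: real
        assume [measurable]: "E' \<in> sets borel" and "0 \<le> \<tau>" "emeasure lborel E' \<le> ennreal \<tau>"
        \<comment> \<open>The sets E' may leave the ball, for instance after a translation; G'
          vanishes outside, so only the part inside counts.\<close>
        have "emeasure lborel (E' \<inter> ?B) \<le> emeasure lborel E'"
          by (rule emeasure_mono) auto
        also note \<open>emeasure lborel E' \<le> ennreal \<tau>\<close>
        finally have "(\<integral>\<^sup>+ x. ennreal (norm (G' x)) * indicator (E' \<inter> ?B) x \<partial>lborel)
          \<le> (\<integral>\<^sup>+ s. h s * indicator {0<..\<tau>} s \<partial>lborel)"
          unfolding h_def using \<open>0 \<le> \<tau>\<close> by (intro hardy_littlewood_decr_rearrangement) auto
        moreover have "ennreal (norm (G' x)) * indicator E' x = ennreal (norm (G' x)) * indicator (E' \<inter> ?B) x" for x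
          using G'(3)[of x] by (auto simp: indicator_def)
        ultimately show "(\<integral>\<^sup>+ x. ennreal (norm (G' x)) * indicator E' x \<partial>lborel)
          \<le> (\<integral>\<^sup>+ s. h s * indicator {0<..\<tau>} s \<partial>lborel)" by simp
      qed (use \<open>0 < \<tau>\<close> in simp)
    qed (simp_all add: E_sets)
    finally show "ennreal \<alpha> * ennreal \<tau> \<le> ennreal (\<rho> * 2 ^ (DIM('a) + 1)) * (\<integral>\<^sup>+ s. h s * indicator {0<..\<tau>} s \<partial>lborel)" .
  qed (use \<rho> in simp)
  moreover have "decr_rearrangement ?B (\<lambda>x. f' x - m) = decr_rearrangement ?B (\<lambda>x. f x - m)"
  proof (intro decr_rearrangement_cong distribution_fun_cong_AE)
    show "AE x in lebesgue. x \<in> ?B \<longrightarrow> f' x - m = f x - m"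
      using f'(2) by eventually_elim auto
    show "set_borel_measurable lebesgue ?B (\<lambda>x. f' x - m)"
      by (rule borel_imp_set_borel_measurable_lebesgue) auto
    have "set_borel_measurable lebesgue ?B (\<lambda>x. m)"
      by (rule borel_imp_set_borel_measurable_lebesgue) auto
    then have "(\<lambda>x. indicator ?B x *\<^sub>R f x - indicator ?B x *\<^sub>R m) \<in> borel_measurable lebesgue"
      using fm unfolding set_borel_measurable_def by (intro borel_measurable_diff)
    then show "set_borel_measurable lebesgue ?B (\<lambda>x. f x - m)"
      by (simp add: set_borel_measurable_def right_diff_distrib)
  qed simp
  moreover have "h = decr_rearrangement ?B G"
    unfolding h_def
  proof (intro decr_rearrangement_cong distribution_fun_cong_AE G)
    show "AE x in lebesgue. x \<in> ?B \<longrightarrow> G' x = G x"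
      using G'(2) by eventually_elim auto
    show "set_borel_measurable lebesgue ?B G'"
      by (rule borel_imp_set_borel_measurable_lebesgue) auto
  qed simp
  ultimately show ?thesis by (simp add: m_def)
qed

theorem lemma2p2:
  fixes p :: real and q :: ennreal
  assumes "CARD('n::finite) > 2" and "1 < p" and "1 \<le> q"
  shows "\<exists>C::real. C > 0 \<and>
    (\<forall>(a :: real ^ 'n) (\<rho> :: real) (f :: real ^ 'n \<Rightarrow> real) (G :: real ^ 'n \<Rightarrow> real ^ 'n).
       \<rho> > 0 \<longrightarrow>
       f absolutely_integrable_on ball a \<rho> \<longrightarrow>
       has_weak_gradient_on f G (ball a \<rho>) \<longrightarrow>
       G \<in> lorentz_space p q (ball a \<rho>) \<longrightarrow>
       lorentz_norm p q (ball a \<rho>) (\<lambda>x. f x - mean_on (ball a \<rho>) f)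
         \<le> ennreal (C * \<rho>) * lorentz_norm p q (ball a \<rho>) G)"
proof (intro exI[of _ "2 ^ (CARD('n) + 1) * (p / (p - 1))"] conjI allI impI)
  \<comment> \<open>The witness is the constant 2^(n+1) of the pointwise estimate times the Hardy
    factor; it depends only on n and p.\<close>
  show "0 < 2 ^ (CARD('n) + 1) * (p / (p - 1))" using assms by simp
  fix a :: "real ^ 'n" and \<rho> :: real and f :: "real ^ 'n \<Rightarrow> real" and G :: "real ^ 'n \<Rightarrow> real ^ 'n"
  assume \<rho>: "0 < \<rho>" and f: "f absolutely_integrable_on ball a \<rho>"
    and wg: "has_weak_gradient_on f G (ball a \<rho>)" and "G \<in> lorentz_space p q (ball a \<rho>)"
  then have "set_borel_measurable lebesgue (ball a \<rho>) G" unfolding lorentz_space_def by blast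
  note poincare = decr_rearrangement_poincare[OF \<rho> f wg this]
  have "0 < \<rho> * 2 ^ (DIM(real ^ 'n) + 1)" using \<rho> by simp
  from lorentz_norm_le_running_mean[OF assms(2,3) this poincare]
  have "lorentz_norm p q (ball a \<rho>) (\<lambda>x. f x - mean_on (ball a \<rho>) f)
    \<le> ennreal ((\<rho> * 2 ^ (DIM(real ^ 'n) + 1)) * (p / (p - 1))) * lorentz_norm p q (ball a \<rho>) G" .
  then show "lorentz_norm p q (ball a \<rho>) (\<lambda>x. f x - mean_on (ball a \<rho>) f)
    \<le> ennreal (2 ^ (CARD('n) + 1) * (p / (p - 1)) * \<rho>) * lorentz_norm p q (ball a \<rho>) G"
    by (simp add: mult_ac)
qed

end
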